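(* In the almost observable model of the stochastic clearing system in alternating environment, suppose that $(\mu_1-\mu_2)(\rho_1-\rho_2)>0$. Then equilibrium reverse-threshold strategies always exist. In particular (uniqueness being understood within the class $\mathcal S_{r-t}=\{\lfloor0\rfloor,\lfloor\infty\rfloor\}\cup\{\lfloor0,\theta_0\rfloor:\theta_0\in(0,1)\}$): Case I: if $H^U(0)>0$, there is a unique equilibrium reverse-threshold strategy, the $\lfloor0\rfloor$ strategy (always join). Case II: suppose $H^U(0)\le0$ and $\lim_{n\to\infty}H^U(n)>0$. If $m_U^-=0$, the $\lfloor0\rfloor$ strategy (always join) is the unique equilibrium reverse-threshold strategy. If $m_L^+\ge1$, the $\lfloor\infty\rfloor$ strategy (always balk) is the unique equilibrium reverse-threshold strategy. Otherwise, the $\lfloor0,\theta(0)\rfloor$ strategy is the unique equilibrium reverse-threshold strategy, where $\theta(0)$ is the unique $\theta\in(0,1)$ with $F(0,\theta)=0$. Case III: if $\lim_{n\to\infty}H^U(n)\le0$, there is a unique equilibrium reverse-threshold strategy, the $\lfloor\infty\rfloor$ strategy (always balk).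
   Context: Model. $\lambda_1,\lambda_2,\mu_1,\mu_2,q_{12},q_{21},R,C$ are positive reals; $\rho_e=\lambda_e/\mu_e$. The environment is a continuous-time Markov chain on $\{1,2\}$ with rates $q_{12}$ (from 1 to 2) and $q_{21}$ (from 2 to 1). While the environment is $e$, customers arrive as a Poisson process of rate $\lambda_e$ and, independently, a facility visits at rate $\mu_e$ and removes all present customers. A customer who joins gets reward $R$ minus $C$ per unit of time until the next visit; balking gives $0$. Almost observable case. An arriving customer observes the number $n$ of customers present but not the environment. A strategy is a vector $s=(\theta_0,\theta_1,\dots)\in[0,1]^{\mathbb N}$, $\theta_n$ being the probability of joining when $n$ customers are seen. Reverse-threshold strategies: $\lfloor n_0,\theta\rfloor$ ($n_0\in\{0,1,\dots\}$, $\theta\in[0,1]$) has $\theta_i=0$ for $i<n_0$, $\theta_{n_0}=\theta$, $\theta_i=1$ for $i>n_0$; $\lfloor n_0\rfloor=\lfloor n_0,1\rfloor$, so $\lfloor0\rfloor$ is "always join"; $\lfloor\infty\rfloor$ has $\theta_i=0$ for all $i$ ("always balk"). Strategies $\lfloor n_0\rfloor$, $\lfloor n_0,\theta_0\rfloor$ with $n_0\ge1$ are excluded, since under them the system stays empty in steady state, making them equivalent to $\lfloor\infty\rfloor$; equilibrium reverse-threshold strategies are sought in $\mathcal S_{r-t}$. Payoffs. When all customers use $s$, the state (number of customers, environment) is a Markov chain on $\{0,1,\dots\}\times\{1,2\}$ with rates $\lambda_e\theta_n$ for $(n,e)\to(n+1,e)$, $\mu_e$ for $(n,e)\to(0,e)$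 ($n\ge1$), $q_{12}$ for $(n,1)\to(n,2)$, $q_{21}$ for $(n,2)\to(n,1)$; let $p_{ao}(n,e;s)$ be its stationary distribution. An arriving customer finds $n$ customers with probability $\pi(n;s)=\frac{\lambda_1p_{ao}(n,1;s)+\lambda_2p_{ao}(n,2;s)}{\sum_m(\lambda_1p_{ao}(m,1;s)+\lambda_2p_{ao}(m,2;s))}$. Let $$T_1=\frac{\mu_2+q_{21}+q_{12}}{K},\quad T_2=\frac{\mu_1+q_{21}+q_{12}}{K},\quad K=\mu_1\mu_2+\mu_1q_{21}+\mu_2q_{12}$$ be the mean times to the next visit from environment 1, 2. For $\pi(n;s)>0$, the expected net benefit of joining when seeing $n$ is $$S_{ao}(n;s)=R-C\,\frac{\lambda_1p_{ao}(n,1;s)T_1+\lambda_2p_{ao}(n,2;s)T_2}{\lambda_1p_{ao}(n,1;s)+\lambda_2p_{ao}(n,2;s)}.$$ The payoff of a tagged customer using $(\theta_n')$ against $s$ is $\mathcal U((\theta'_n),s)=\sum_{n:\pi(n;s)>0}\pi(n;s)\,\theta_n'\,S_{ao}(n;s)$. A strategy $s$ is an equilibrium if $\mathcal U(s,s)\ge\mathcal U(s',s)$ for every strategy $s'$. Functions. $p_E(1)=\frac{q_{21}}{q_{12}+q_{21}}$, $p_E(2)=\frac{q_{12}}{q_{12}+q_{21}}$, $\Delta=[\lambda_2(\mu_1+q_{12})-\lambda_1(\mu_2+q_{21})]^2+4\lambda_1\lambda_2q_{12}q_{21}$, $z_{1,2}=\frac{-\lambda_1(\mu_2+q_{21})-\lambda_2(\mu_1+q_{12})\pm\sqrt\Delta}{2\lambda_1\lambda_2}$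 ($z_1$ with $+$, $z_2$ with $-$); $A_1=\frac{(\mu_1\lambda_2z_1+K)p_E(1)}{\sqrt\Delta(1-z_1)}$, $B_1=-\frac{(\mu_1\lambda_2z_2+K)p_E(1)}{\sqrt\Delta(1-z_2)}$, $A_2=\frac{(\mu_2\lambda_1z_1+K)p_E(2)}{\sqrt\Delta(1-z_1)}$, $B_2=-\frac{(\mu_2\lambda_1z_2+K)p_E(2)}{\sqrt\Delta(1-z_2)}$; $A=\lambda_1A_1T_1+\lambda_2A_2T_2$, $B=\lambda_1B_1T_1+\lambda_2B_2T_2$, $D=\lambda_1A_1+\lambda_2A_2$, $E=\lambda_1B_1+\lambda_2B_2$. For $n\ge0$, $\theta\in[0,1]$ (with $0^0=1$), $$F(n,\theta)=\sum_{i=n}^\infty(1-\theta)^{i-n}\Bigl[(RD-CA)\bigl(\tfrac1{1-z_1}\bigr)^i+(RE-CB)\bigl(\tfrac1{1-z_2}\bigr)^i\Bigr],$$ $$G(n,\theta)=\sum_{i=n}^\infty(1-\theta)^{i-n}\Bigl[D\bigl(\tfrac1{1-z_1}\bigr)^i+E\bigl(\tfrac1{1-z_2}\bigr)^i\Bigr],\qquad H^U(n)=\frac{F(n,1)}{G(n,1)}.$$ With $\inf\emptyset=\infty$: $m_U^-=\inf\{n\ge0:F(n,1)\ge0\}$ and $m_L^+=\inf\{n\ge0:F(n,0)>0\}$. *)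

theory Defs
  imports "HOL-Analysis.Analysis" "HOL-Library.Extended_Nat"
begin

section \<open>The model\<close>

datatype env = E1 | E2

fun other :: "env \<Rightarrow> env" where
  "other E1 = E2"
| "other E2 = E1"

text \<open>\<open>switch_rate M e\<close> is the rate at which the environment leaves \<open>e\<close>, i.e.
  \<open>q\<^sub>1\<^sub>2\<close> for \<open>e = E1\<close> and \<open>q\<^sub>2\<^sub>1\<close> for \<open>e = E2\<close>. The other two rates are
  \<open>\<lambda>\<^sub>e\<close> and \<open>\<mu>\<^sub>e\<close>.\<close>

record clearing_model =
  arr_rate :: "env \<Rightarrow> real"
  visit_rate :: "env \<Rightarrow> real"
  switch_rate :: "env \<Rightarrow> real"
  reward :: real
  cost :: real

definition positive_params :: "clearing_model \<Rightarrow> bool" where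
  "positive_params M \<longleftrightarrow>
     (\<forall>e. arr_rate M e > 0 \<and> visit_rate M e > 0 \<and> switch_rate M e > 0) \<and>
     reward M > 0 \<and> cost M > 0"

definition rho :: "clearing_model \<Rightarrow> env \<Rightarrow> real" where
  "rho M e = arr_rate M e / visit_rate M e"


section \<open>Strategies\<close>

type_synonym strat = "nat \<Rightarrow> real"

definition strategies :: "strat set" where
  "strategies = {s. \<forall>n. 0 \<le> s n \<and> s n \<le> 1}"

definition rev_threshold :: "nat \<Rightarrow> real \<Rightarrow> strat" where
  "rev_threshold n\<^sub>0 \<theta> = (\<lambda>i. if i < n\<^sub>0 then 0 else if i = n\<^sub>0 then \<theta> else 1)"

definition always_join :: strat where
  "always_join = rev_threshold 0 1"

definition always_balk :: strat where
  "always_balk = (\<lambda>_. 0)"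

definition S_rt :: "strat set" where
  "S_rt = {always_join, always_balk} \<union> {rev_threshold 0 \<theta> | \<theta>. \<theta> \<in> {0<..<1}}"


section \<open>The Markov chain and its stationary distribution\<close>

fun trans_rate :: "clearing_model \<Rightarrow> strat \<Rightarrow> nat \<times> env \<Rightarrow> nat \<times> env \<Rightarrow> real" where
  "trans_rate M s (n, e) (m, e') =
     (if m = Suc n \<and> e' = e then arr_rate M e * s n
      else if n \<ge> 1 \<and> m = 0 \<and> e' = e then visit_rate M e
      else if m = n \<and> e' = other e then switch_rate M e
      else 0)"

text \<open>Stationarity of \<open>p\<close> for a continuous-time Markov chain with off-diagonal rates \<open>q\<close>:
  \<open>p\<close> is a probability distribution solving the balance equations (\<open>pQ = 0\<close>), inflow on the left
  and outflow on the right. The rates used here are bounded, so the chain does not explode.\<close>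

definition stationary_distr :: "('s \<Rightarrow> 's \<Rightarrow> real) \<Rightarrow> ('s \<Rightarrow> real) \<Rightarrow> bool" where
  "stationary_distr q p \<longleftrightarrow>
     (\<forall>x. 0 \<le> p x) \<and> (p has_sum 1) UNIV \<and>
     (\<forall>y. ((\<lambda>x. p x * q x y) has_sum (p y * (\<Sum>\<^sub>\<infinity>x\<in>-{y}. q y x))) (-{y}))"

definition p_ao :: "clearing_model \<Rightarrow> strat \<Rightarrow> nat \<Rightarrow> env \<Rightarrow> real" where
  "p_ao M s n e = (THE p. stationary_distr (trans_rate M s) p) (n, e)"


section \<open>Payoffs and equilibria\<close>

definition K_const :: "clearing_model \<Rightarrow> real" where
  "K_const M = visit_rate M E1 * visit_rate M E2 + visit_rate M E1 * switch_rate M E2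
     + visit_rate M E2 * switch_rate M E1"

definition mean_visit_time :: "clearing_model \<Rightarrow> env \<Rightarrow> real" where
  "mean_visit_time M e =
     (visit_rate M (other e) + switch_rate M E2 + switch_rate M E1) / K_const M"

definition arr_weight :: "clearing_model \<Rightarrow> strat \<Rightarrow> nat \<Rightarrow> real" where
  "arr_weight M s n = arr_rate M E1 * p_ao M s n E1 + arr_rate M E2 * p_ao M s n E2"

definition arr_prob :: "clearing_model \<Rightarrow> strat \<Rightarrow> nat \<Rightarrow> real" where
  "arr_prob M s n = arr_weight M s n / (\<Sum>\<^sub>\<infinity>m. arr_weight M s m)"

text \<open>Meaningful only where \<open>arr_prob M s n > 0\<close>.\<close>

definition S_ao :: "clearing_model \<Rightarrow> strat \<Rightarrow> nat \<Rightarrow> real" where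
  "S_ao M s n = reward M - cost M *
     ((arr_rate M E1 * p_ao M s n E1 * mean_visit_time M E1
       + arr_rate M E2 * p_ao M s n E2 * mean_visit_time M E2) / arr_weight M s n)"

definition payoff :: "clearing_model \<Rightarrow> strat \<Rightarrow> strat \<Rightarrow> real" where
  "payoff M s' s = (\<Sum>\<^sub>\<infinity>n\<in>{n. arr_prob M s n > 0}. arr_prob M s n * s' n * S_ao M s n)"

definition equilibrium :: "clearing_model \<Rightarrow> strat \<Rightarrow> bool" where
  "equilibrium M s \<longleftrightarrow>
     s \<in> strategies \<and> (\<forall>s'\<in>strategies. payoff M s s \<ge> payoff M s' s)"

definition rt_equilibria :: "clearing_model \<Rightarrow> strat set" where
  "rt_equilibria M = {s \<in> S_rt. equilibrium M s}"


section \<open>The auxiliary functions\<close>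

definition p_E :: "clearing_model \<Rightarrow> env \<Rightarrow> real" where
  "p_E M e = switch_rate M (other e) / (switch_rate M E1 + switch_rate M E2)"

definition Delta :: "clearing_model \<Rightarrow> real" where
  "Delta M = (arr_rate M E2 * (visit_rate M E1 + switch_rate M E1)
              - arr_rate M E1 * (visit_rate M E2 + switch_rate M E2))\<^sup>2
             + 4 * arr_rate M E1 * arr_rate M E2 * switch_rate M E1 * switch_rate M E2"

definition z1 :: "clearing_model \<Rightarrow> real" where
  "z1 M = (- arr_rate M E1 * (visit_rate M E2 + switch_rate M E2)
           - arr_rate M E2 * (visit_rate M E1 + switch_rate M E1) + sqrt (Delta M))
          / (2 * arr_rate M E1 * arr_rate M E2)"

definition z2 :: "clearing_model \<Rightarrow> real" where
  "z2 M = (- arr_rate M E1 * (visit_rate M E2 + switch_rate M E2)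
           - arr_rate M E2 * (visit_rate M E1 + switch_rate M E1) - sqrt (Delta M))
          / (2 * arr_rate M E1 * arr_rate M E2)"

text \<open>\<open>coef_A_env M e\<close> and \<open>coef_B_env M e\<close> are \<open>A\<^sub>e\<close> and \<open>B\<^sub>e\<close>;
  \<open>coef_A\<close> and \<open>coef_B\<close> are the combinations \<open>A\<close> and \<open>B\<close>.\<close>

definition coef_A_env :: "clearing_model \<Rightarrow> env \<Rightarrow> real" where
  "coef_A_env M e = (visit_rate M e * arr_rate M (other e) * z1 M + K_const M) * p_E M e
                    / (sqrt (Delta M) * (1 - z1 M))"

definition coef_B_env :: "clearing_model \<Rightarrow> env \<Rightarrow> real" where
  "coef_B_env M e = - ((visit_rate M e * arr_rate M (other e) * z2 M + K_const M) * p_E M e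
                       / (sqrt (Delta M) * (1 - z2 M)))"

definition coef_A :: "clearing_model \<Rightarrow> real" where
  "coef_A M = arr_rate M E1 * coef_A_env M E1 * mean_visit_time M E1
              + arr_rate M E2 * coef_A_env M E2 * mean_visit_time M E2"

definition coef_B :: "clearing_model \<Rightarrow> real" where
  "coef_B M = arr_rate M E1 * coef_B_env M E1 * mean_visit_time M E1
              + arr_rate M E2 * coef_B_env M E2 * mean_visit_time M E2"

definition coef_D :: "clearing_model \<Rightarrow> real" where
  "coef_D M = arr_rate M E1 * coef_A_env M E1 + arr_rate M E2 * coef_A_env M E2"

definition coef_E :: "clearing_model \<Rightarrow> real" where
  "coef_E M = arr_rate M E1 * coef_B_env M E1 + arr_rate M E2 * coef_B_env M E2"

definition F_fun :: "clearing_model \<Rightarrow> nat \<Rightarrow> real \<Rightarrow> real" where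
  "F_fun M n \<theta> = (\<Sum>\<^sub>\<infinity>i\<in>{n..}. (1 - \<theta>) ^ (i - n) *
     ((reward M * coef_D M - cost M * coef_A M) * (1 / (1 - z1 M)) ^ i
      + (reward M * coef_E M - cost M * coef_B M) * (1 / (1 - z2 M)) ^ i))"

definition G_fun :: "clearing_model \<Rightarrow> nat \<Rightarrow> real \<Rightarrow> real" where
  "G_fun M n \<theta> = (\<Sum>\<^sub>\<infinity>i\<in>{n..}. (1 - \<theta>) ^ (i - n) *
     (coef_D M * (1 / (1 - z1 M)) ^ i + coef_E M * (1 / (1 - z2 M)) ^ i))"

definition H_U :: "clearing_model \<Rightarrow> nat \<Rightarrow> real" where
  "H_U M n = F_fun M n 1 / G_fun M n 1"

text \<open>On \<^typ>\<open>enat\<close>, \<open>Inf {} = \<infinity>\<close>.\<close>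

definition m_U_minus :: "clearing_model \<Rightarrow> enat" where
  "m_U_minus M = Inf {enat n | n. F_fun M n 1 \<ge> 0}"

definition m_L_plus :: "clearing_model \<Rightarrow> enat" where
  "m_L_plus M = Inf {enat n | n. F_fun M n 0 > 0}"

end

theory Submission
  imports Defs
begin

text \<open>
The hypothesis \<open>(\<mu>\<^sub>1 - \<mu>\<^sub>2)(\<rho>\<^sub>1 - \<rho>\<^sub>2) > 0\<close> says that the environment in which the facility visits
more often is also the one in which more customers would accumulate between visits if the environment
never changed. Seeing many customers is therefore a sign of a short wait, and joining becomes more
attractive as \<open>n\<close> grows. The proof makes this precise in three steps.

First, the stationary distribution. The balance equations, with the environment marginal put in
for the inflow into the empty state, form a recursion over \<open>n\<close> of \<open>2 \<times> 2\<close> systems with positive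
solutions (\<open>level_equations\<close>). It has one solution, which is automatically a probability distribution
and the stationary one (\<open>p_ao_eqI\<close>). If customers join an empty facility with
probability \<open>\<theta>\<close> and a nonempty one always, the chain is a random thinning of the always-join chain;
this gives the solution in closed form (\<open>p_rt\<close>) and shows that the weighted benefit of joining is
\<open>F(0,\<theta>)\<close> in the empty state and \<open>\<theta> F(n,\<theta>)\<close> at \<open>n \<ge> 1\<close>. The case \<open>\<theta> = 0\<close> also describes
\<open>always_balk\<close>.

Second, a strategy is an equilibrium iff it is optimal separately at every \<open>n\<close> that arriving
customers see (\<open>equilibrium_iff\<close>), which is a condition on the signs of \<open>F(n,\<theta>)\<close>.

Third, the signs. \<open>F\<close> and \<open>G\<close> are combinations of the same two geometric modes, so the monotonicity
of \<open>F/G\<close>, both in \<open>n\<close> and in \<open>\<theta>\<close>, is governed by a single determinant (\<open>F_G_cross\<close>). Under the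
hypothesis that determinant is positive (\<open>mode_det_pos\<close>). Hence \<open>F(n,\<theta>)/G(n,\<theta>)\<close> increases in \<open>n\<close>,
so that only the empty state matters, and \<open>F(0,\<theta>)/G(0,\<theta>)\<close> decreases in \<open>\<theta>\<close>, so that exactly one
\<open>\<theta> \<in> [0,1]\<close> is consistent: \<open>1\<close> if \<open>F(0,1) \<ge> 0\<close>, \<open>0\<close> if \<open>F(0,0) \<le> 0\<close>, and the root of
\<open>F(0,\<theta>)\<close> otherwise (\<open>rt_equilibria_cases\<close>).
\<close>

section \<open>Two-state systems of linear equations\<close>

lemma other_neq [simp]: "other e \<noteq> e" "e \<noteq> other e" "other (other e) = e"
  by (cases e; simp)+

lemma has_sum_prod_env:
  fixes p :: "nat \<Rightarrow> env \<Rightarrow> real"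
  assumes "\<And>e. ((\<lambda>n. p n e) has_sum P e) UNIV"
  shows "((\<lambda>(n, e). p n e) has_sum (P E1 + P E2)) UNIV"
proof -
  have "((\<lambda>(n, e). p n e) has_sum P e) (range (\<lambda>n. (n, e)))" for e
    using assms[of e] by (subst has_sum_reindex) (auto simp: inj_on_def o_def)
  from has_sum_Un_disjoint[OF this[of E1] this[of E2]]
  have "((\<lambda>(n, e). p n e) has_sum (P E1 + P E2)) (range (\<lambda>n. (n, E1)) \<union> range (\<lambda>n. (n, E2)))"
    by auto
  moreover have "range (\<lambda>n::nat. (n, E1)) \<union> range (\<lambda>n. (n, E2)) = UNIV"
    by (auto simp: image_iff) (metis env.exhaust)
  ultimately show ?thesis by (simp only:)
qed

locale clearing =
  fixes M :: clearing_model
  assumes positive: "positive_params M"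
begin

abbreviation "lam \<equiv> arr_rate M"
abbreviation "mu \<equiv> visit_rate M"
abbreviation "sw \<equiv> switch_rate M"

lemma rates_pos [simp]: "lam e > 0" "mu e > 0" "sw e > 0" "reward M > 0" "cost M > 0"
  using positive by (auto simp: positive_params_def)

lemma rates_nonneg [simp]: "lam e \<ge> 0" "mu e \<ge> 0" "sw e \<ge> 0"
  by (simp_all add: less_imp_le)

lemma p_E_pos: "p_E M e > 0"
  by (cases e) (simp_all add: p_E_def add_pos_pos)

lemma p_E_sum: "p_E M E1 + p_E M E2 = 1"
proof -
  have "sw E1 + sw E2 > 0" by (simp add: add_pos_pos)
  then show ?thesis by (simp add: p_E_def divide_simps)
qed

lemma p_E_balance: "sw e * p_E M e = sw (other e) * p_E M (other e)"
  by (cases e) (simp_all add: p_E_def)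

text \<open>\<open>p_E\<close> is the stationary distribution of the environment alone; every stationary distribution of
the full chain will turn out to have it as its environment marginal.\<close>

lemma p_E_unique:
  assumes "sw E1 * P E1 = sw E2 * P E2" "P E1 + P E2 = 1"
  shows "P e = p_E M e"
proof -
  have nz: "sw E1 + sw E2 > 0" by (simp add: add_pos_pos)
  have "P E1 * (sw E1 + sw E2) = sw E2" "P E2 * (sw E1 + sw E2) = sw E1"
    using assms by algebra+
  with nz show ?thesis by (cases e) (simp_all add: p_E_def field_simps)
qed

text \<open>All balance equations below come in pairs, one for each environment, coupled only through
the switching rates. Cramer's rule solves such a pair; as the determinant
\<open>c\<^sub>1c\<^sub>2 + c\<^sub>1q\<^sub>2 + c\<^sub>2q\<^sub>1\<close> and all coefficients of \<open>u\<close> are positive, the solution is unique and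
inherits the sign of \<open>u\<close>.\<close>

lemma two_env_solution:
  assumes eq: "\<And>e. (c e + sw e) * v e = u e + sw (other e) * v (other e)"
    and c: "\<And>e. c e > 0"
  shows "v e = ((c (other e) + sw (other e)) * u e + sw (other e) * u (other e))
                / (c e * c (other e) + c e * sw (other e) + sw e * c (other e))" (is "_ = ?r / ?d")
proof -
  have d: "?d > 0" using c by (simp add: add_pos_pos)
  have "v e * ?d = ?r"
    using eq[of e] eq[of "other e"] by (simp, algebra)
  with d show ?thesis by (simp add: field_simps)
qed

lemma two_env_unique:
  assumes "\<And>e. (c e + sw e) * v e = u e + sw (other e) * v (other e)"
    and "\<And>e. (c e + sw e) * w e = u e + sw (other e) * w (other e)"
    and "\<And>e. c e > 0"
  shows "v e = w e"
  using two_env_solution[of c v u e] two_env_solution[of c w u e] assms by simp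

lemma two_env_nonneg:
  assumes "\<And>e. (c e + sw e) * v e = u e + sw (other e) * v (other e)"
    and c: "\<And>e. c e > 0" and u: "\<And>e. u e \<ge> 0"
  shows "v e \<ge> 0"
proof -
  have "c e \<ge> 0" for e using c less_imp_le by blast
  then show ?thesis
    using two_env_solution[of c v u e] assms by (auto intro!: divide_nonneg_nonneg add_nonneg_nonneg)
qed

lemma two_env_pos:
  assumes "\<And>e. (c e + sw e) * v e = u e + sw (other e) * v (other e)"
    and c: "\<And>e. c e > 0" and u: "\<And>e. u e > 0"
  shows "v e > 0"
  using two_env_solution[of c v u e] assms by (auto intro!: divide_pos_pos add_pos_pos mult_pos_pos)

section \<open>The stationary distribution as a recursion over queue lengths\<close>

text \<open>For \<open>n \<ge> 1\<close> these are the balance equations of the chain. For \<open>n = 0\<close> the inflow caused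
by visits is rewritten with the environment marginal:
\<open>\<Sum>\<^bsub>m\<ge>1\<^esub> \<mu>\<^sub>e p(m,e) = \<mu>\<^sub>e (p\<^sub>E(e) - p(0,e))\<close>. This makes the system triangular in \<open>n\<close>: each
level is a \<open>2 \<times> 2\<close> system driven by the previous level.\<close>

definition level_equations :: "strat \<Rightarrow> (nat \<Rightarrow> env \<Rightarrow> real) \<Rightarrow> bool" where
  "level_equations s p \<longleftrightarrow>
     (\<forall>e. ((lam e * s 0 + mu e) + sw e) * p 0 e
            = mu e * p_E M e + sw (other e) * p 0 (other e)) \<and>
     (\<forall>n e. ((lam e * s (Suc n) + mu e) + sw e) * p (Suc n) e
            = lam e * s n * p n e + sw (other e) * p (Suc n) (other e))"

context
  fixes s :: strat
  assumes s: "s \<in> strategies"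
begin

lemma strategy_bounds: "0 \<le> s n" "s n \<le> 1"
  using s by (auto simp: strategies_def)

lemma out_rate_pos: "lam e * s n + mu e > 0"
  by (intro add_nonneg_pos mult_nonneg_nonneg strategy_bounds) simp_all

lemma level_equations_unique:
  assumes "level_equations s p" "level_equations s p'"
  shows "p n e = p' n e"
proof (induction n arbitrary: e)
  case 0
  show ?case
    by (rule two_env_unique[where c = "\<lambda>e. lam e * s 0 + mu e" and u = "\<lambda>e. mu e * p_E M e"])
      (use assms out_rate_pos in \<open>auto simp: level_equations_def\<close>)
next
  case (Suc n)
  show ?case
    by (rule two_env_unique[where c = "\<lambda>e. lam e * s (Suc n) + mu e"
          and u = "\<lambda>e. lam e * s n * p n e"])
      (use assms out_rate_pos Suc in \<open>auto simp: level_equations_def\<close>)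
qed

lemma level_equations_nonneg:
  assumes "level_equations s p"
  shows "p n e \<ge> 0"
proof (induction n arbitrary: e)
  case 0
  show ?case
    by (rule two_env_nonneg[where c = "\<lambda>e. lam e * s 0 + mu e" and u = "\<lambda>e. mu e * p_E M e"])
      (use assms out_rate_pos p_E_pos in \<open>auto simp: level_equations_def less_imp_le\<close>)
next
  case (Suc n)
  show ?case
    by (rule two_env_nonneg[where c = "\<lambda>e. lam e * s (Suc n) + mu e"
          and u = "\<lambda>e. lam e * s n * p n e"])
      (use assms out_rate_pos Suc strategy_bounds in \<open>auto simp: level_equations_def\<close>)
qed

lemma level_equations_pos_0:
  assumes "level_equations s p"
  shows "p 0 e > 0"
  by (rule two_env_pos[where c = "\<lambda>e. lam e * s 0 + mu e" and u = "\<lambda>e. mu e * p_E M e"])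
    (use assms out_rate_pos p_E_pos in \<open>auto simp: level_equations_def\<close>)

lemma level_equations_pos:
  assumes "level_equations s p" "\<And>i. i < n \<Longrightarrow> s i > 0"
  shows "p n e > 0"
  using assms(2)
proof (induction n arbitrary: e)
  case 0
  show ?case using level_equations_pos_0[OF assms(1)] .
next
  case (Suc n)
  show ?case
    by (rule two_env_pos[where c = "\<lambda>e. lam e * s (Suc n) + mu e"
          and u = "\<lambda>e. lam e * s n * p n e"])
      (use assms(1) out_rate_pos Suc in \<open>auto simp: level_equations_def\<close>)
qed

text \<open>Summing the levels up to \<open>N\<close> telescopes the arrival terms; what remains is the same
\<open>2 \<times> 2\<close> system that \<open>p_E\<close> solves, up to the flow out of level \<open>N\<close>.\<close>

lemma level_equations_partial_sum:
  assumes "level_equations s p"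
  shows "(mu e + sw e) * (\<Sum>n\<le>N. p n e) + lam e * s N * p N e
         = mu e * p_E M e + sw (other e) * (\<Sum>n\<le>N. p n (other e))"
proof (induction N)
  case 0
  show ?case using assms by (simp add: level_equations_def algebra_simps)
next
  case (Suc N)
  have "((lam e * s (Suc N) + mu e) + sw e) * p (Suc N) e
            = lam e * s N * p N e + sw (other e) * p (Suc N) (other e)"
    using assms by (simp add: level_equations_def)
  with Suc show ?case by (simp add: algebra_simps)
qed

text \<open>Summability is a consequence of the recursion: adding the two truncated balances cancels the
switching terms and bounds the partial sums. Hence the flow out of level \<open>N\<close> vanishes in the limit
and the total masses solve the \<open>2 \<times> 2\<close> system of \<open>p_E\<close>.\<close>

lemma level_equations_marginal:
  assumes eqs: "level_equations s p"
  shows "((\<lambda>n. p n e) has_sum p_E M e) UNIV"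
proof -
  note nonneg = level_equations_nonneg[OF eqs]
  have bound: "(\<Sum>n\<le>N. p n e) \<le> (mu E1 * p_E M E1 + mu E2 * p_E M E2) / mu e" for N e
  proof -
    have "mu E1 * (\<Sum>n\<le>N. p n E1) + mu E2 * (\<Sum>n\<le>N. p n E2)
          + (lam E1 * s N * p N E1 + lam E2 * s N * p N E2)
        = mu E1 * p_E M E1 + mu E2 * p_E M E2"
      using level_equations_partial_sum[OF eqs, of E1 N] level_equations_partial_sum[OF eqs, of E2 N]
      by (simp add: algebra_simps)
    moreover have "lam E1 * s N * p N E1 + lam E2 * s N * p N E2 \<ge> 0"
      using nonneg strategy_bounds by simp
    moreover have "mu e * (\<Sum>n\<le>N. p n e) \<ge> 0" for e
      using nonneg by (intro mult_nonneg_nonneg sum_nonneg) auto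
    from this[of E1] this[of E2] calculation
    have "mu e * (\<Sum>n\<le>N. p n e) \<le> mu E1 * p_E M E1 + mu E2 * p_E M E2"
      by (cases e) simp_all
    then show ?thesis by (simp add: pos_le_divide_eq mult.commute)
  qed
  have summable: "summable (\<lambda>n. p n e)" for e
  proof (rule summableI_nonneg_bounded)
    show "(\<Sum>n<N. p n e) \<le> (mu E1 * p_E M E1 + mu E2 * p_E M E2) / mu e" for N
      using bound[of e N] nonneg[of N e] by (simp add: lessThan_Suc_atMost[symmetric])
  qed (rule nonneg)
  define L where "L e = (\<Sum>n. p n e)" for e
  have lim: "(\<lambda>N. \<Sum>n\<le>N. p n e) \<longlonglongrightarrow> L e" for e
    unfolding L_def using summable by (rule summable_LIMSEQ')
  have zero: "(\<lambda>N. lam e * s N * p N e) \<longlonglongrightarrow> 0" for e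
  proof (rule tendsto_sandwich[of "\<lambda>_. 0" _ _ "\<lambda>N. lam e * p N e"])
    show "(\<lambda>N. lam e * p N e) \<longlonglongrightarrow> 0"
      using tendsto_mult_left[OF summable_LIMSEQ_zero[OF summable[of e]], of "lam e"] by simp
    show "\<forall>\<^sub>F N in sequentially. lam e * s N * p N e \<le> lam e * p N e"
      using nonneg strategy_bounds by (simp add: mult_left_le_one_le mult.assoc)
  qed (use nonneg strategy_bounds in auto)
  have limit_eq: "(mu e + sw e) * L e = mu e * p_E M e + sw (other e) * L (other e)" for e
  proof (rule LIMSEQ_unique)
    show "(\<lambda>N. (mu e + sw e) * (\<Sum>n\<le>N. p n e) + lam e * s N * p N e) \<longlonglongrightarrow> (mu e + sw e) * L e"
      using tendsto_add[OF tendsto_mult_left[OF lim[of e], of "mu e + sw e"] zero[of e]] by simp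
    show "(\<lambda>N. (mu e + sw e) * (\<Sum>n\<le>N. p n e) + lam e * s N * p N e)
            \<longlonglongrightarrow> mu e * p_E M e + sw (other e) * L (other e)"
      unfolding level_equations_partial_sum[OF eqs]
      by (intro tendsto_intros lim)
  qed
  have "L e = p_E M e" for e
    by (rule two_env_unique[where c = mu and u = "\<lambda>e. mu e * p_E M e"])
      (use limit_eq p_E_balance in \<open>auto simp: algebra_simps\<close>)
  moreover have "((\<lambda>n. p n e) has_sum L e) UNIV"
    unfolding L_def by (intro sums_nonneg_imp_has_sum summable_sums summable nonneg)
  ultimately show ?thesis by simp
qed

lemma outflow:
  "(\<Sum>\<^sub>\<infinity>x\<in>-{(n, e)}. trans_rate M s (n, e) x) = lam e * s n + (if n = 0 then 0 else mu e) + sw e"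
proof -
  let ?S = "{(Suc n, e), (n, other e)} \<union> (if n = 0 then {} else {(0, e)})"
  have "(\<Sum>\<^sub>\<infinity>x\<in>-{(n, e)}. trans_rate M s (n, e) x) = (\<Sum>\<^sub>\<infinity>x\<in>?S. trans_rate M s (n, e) x)"
    by (rule infsum_cong_neutral) (auto split: if_splits)
  also have "\<dots> = lam e * s n + (if n = 0 then 0 else mu e) + sw e"
    by (subst infsum_finite) (auto simp: algebra_simps)
  finally show ?thesis .
qed

lemma inflow_Suc:
  "((\<lambda>x. p x * trans_rate M s x (Suc n, e)) has_sum
     (p (n, e) * (lam e * s n) + p (Suc n, other e) * sw (other e))) (-{(Suc n, e)})"
proof (subst has_sum_cong_neutral[where T = "{(n, e), (Suc n, other e)}"
      and g = "\<lambda>x. p x * trans_rate M s x (Suc n, e)"])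
  fix x :: "nat \<times> env" assume "x \<in> -{(Suc n, e)} - {(n, e), (Suc n, other e)}"
  then show "p x * trans_rate M s x (Suc n, e) = 0"
    by (cases x; cases e; cases "snd x") auto
qed (auto intro!: has_sum_finiteI)

text \<open>The empty state is the only one entered from infinitely many others; the sum over all of them
is read off from the total mass of the environment.\<close>

lemma inflow_0:
  assumes "((\<lambda>n. p (n, e)) has_sum P) UNIV"
  shows "((\<lambda>x. p x * trans_rate M s x (0, e)) has_sum
     (mu e * (P - p (0, e)) + p (0, other e) * sw (other e))) (-{(0, e)})"
proof -
  let ?f = "\<lambda>x. p x * trans_rate M s x (0, e)"
  have "((\<lambda>n. p (n, e)) has_sum (P - p (0, e))) (UNIV - {0})"
    by (intro has_sum_Diff assms) (auto intro!: has_sum_finiteI)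
  from has_sum_cmult_right[OF this, of "mu e"]
  have "((\<lambda>n. mu e * p (n, e)) has_sum (mu e * (P - p (0, e)))) (UNIV - {0})" .
  then have "(?f has_sum (mu e * (P - p (0, e)))) ((\<lambda>n. (n, e)) ` (UNIV - {0}))"
    by (subst has_sum_reindex, simp add: inj_on_def, elim has_sum_cong[THEN iffD1, rotated])
      (auto simp: mult.commute)
  moreover have "(?f has_sum p (0, other e) * sw (other e)) {(0, other e)}"
    by (rule has_sum_finiteI) auto
  ultimately have "(?f has_sum (mu e * (P - p (0, e)) + p (0, other e) * sw (other e)))
      ((\<lambda>n. (n, e)) ` (UNIV - {0}) \<union> {(0, other e)})"
    by (rule has_sum_Un_disjoint) auto
  then show ?thesis
  proof (subst has_sum_cong_neutral[where T = "(\<lambda>n. (n, e)) ` (UNIV - {0}) \<union> {(0, other e)}"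
        and g = ?f])
    fix x :: "nat \<times> env" assume "x \<in> -{(0, e)} - ((\<lambda>n. (n, e)) ` (UNIV - {0}) \<union> {(0, other e)})"
    then show "?f x = 0"
      by (cases x; cases e; cases "snd x") (auto simp: image_iff)
  qed auto
qed

lemma level_equations_stationary:
  assumes eqs: "level_equations s p"
  shows "stationary_distr (trans_rate M s) (\<lambda>(n, e). p n e)"
  unfolding stationary_distr_def
proof (intro conjI allI)
  fix x :: "nat \<times> env"
  show "0 \<le> (case x of (n, e) \<Rightarrow> p n e)"
    using level_equations_nonneg[OF eqs] by (cases x) auto
  show "((\<lambda>x. (case x of (n, e) \<Rightarrow> p n e) * trans_rate M s x y) has_sum
           (case y of (n, e) \<Rightarrow> p n e) * infsum (trans_rate M s y) (- {y})) (- {y})"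
    for y :: "nat \<times> env"
  proof (cases y)
    case y: (Pair n e)
    show ?thesis
    proof (cases n)
      case 0
      have "mu e * p_E M e + sw (other e) * p 0 (other e) = (lam e * s 0 + mu e + sw e) * p 0 e"
        using eqs by (simp add: level_equations_def)
      then have "p 0 e * (lam e * s 0 + sw e) = mu e * (p_E M e - p 0 e) + p 0 (other e) * sw (other e)"
        by (simp add: algebra_simps)
      with inflow_0[of "\<lambda>(n, e). p n e" e "p_E M e"] level_equations_marginal[OF eqs, of e] y 0
      show ?thesis by (simp add: outflow del: trans_rate.simps)
    next
      case (Suc m)
      have "p n e * (lam e * s n + mu e + sw e)
           = p m e * (lam e * s m) + p n (other e) * sw (other e)"
        using eqs Suc by (simp add: level_equations_def algebra_simps)
      with inflow_Suc[of "\<lambda>(n, e). p n e" m e] y Suc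
      show ?thesis by (simp add: outflow del: trans_rate.simps)
    qed
  qed
next
  show "((\<lambda>(n, e). p n e) has_sum 1) UNIV"
    using has_sum_prod_env[of p "p_E M", OF level_equations_marginal[OF eqs]] by (simp only: p_E_sum)
qed

text \<open>Only the environment marginal is not immediate. Summing the balance equations over \<open>n \<ge> 1\<close>
and adding the one at \<open>n = 0\<close> cancels arrivals and visits, which leaves the balance of the
environment chain.\<close>

lemma stationary_level_equations:
  assumes st: "stationary_distr (trans_rate M s) p"
  shows "level_equations s (\<lambda>n e. p (n, e))"
proof -
  have nonneg: "p x \<ge> 0" and total: "(p has_sum 1) UNIV"
    and bal: "((\<lambda>x. p x * trans_rate M s x y) has_sum
                (p y * infsum (trans_rate M s y) (- {y}))) (- {y})" for x y
    using st unfolding stationary_distr_def by blast+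
  have summable: "(\<lambda>n. p (n, e)) summable_on UNIV" for e
  proof -
    have "p summable_on range (\<lambda>n. (n, e))"
      using summable_on_subset_banach[OF has_sum_imp_summable[OF total] subset_UNIV] .
    then show ?thesis by (subst (asm) summable_on_reindex) (auto simp: inj_on_def o_def)
  qed
  define P where "P e = (\<Sum>\<^sub>\<infinity>n. p (n, e))" for e
  have P: "((\<lambda>n. p (n, e)) has_sum P e) UNIV" for e
    unfolding P_def by (rule has_sum_infsum[OF summable])
  have eq0: "p (0, e) * (lam e * s 0 + sw e)
              = mu e * (P e - p (0, e)) + p (0, other e) * sw (other e)" for e
    using has_sum_unique[OF bal[of "(0, e)"] inflow_0[OF P]] by (simp add: outflow)
  have eqSuc: "p (Suc n, e) * (lam e * s (Suc n) + mu e + sw e)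
              = p (n, e) * (lam e * s n) + p (Suc n, other e) * sw (other e)" for n e
    using has_sum_unique[OF bal[of "(Suc n, e)"] inflow_Suc] by (simp add: outflow)
  have total_env: "P E1 + P E2 = 1"
    using has_sum_unique[OF total] has_sum_prod_env[of "\<lambda>n e. p (n, e)" P, OF P]
    by (simp add: case_prod_unfold)
  have PE: "P e = p_E M e" for e
  proof (rule p_E_unique[OF _ total_env])
    have sJ: "(\<lambda>n. p (n, E1) * s n) summable_on UNIV"
    proof (rule summable_on_comparison_test[where f = "\<lambda>n. p (n, E1)"])
    qed (use nonneg strategy_bounds summable in \<open>auto simp: mult_right_le_one_le\<close>)
    then obtain J where J: "((\<lambda>n. p (n, E1) * s n) has_sum J) UNIV"
      by (auto simp: summable_on_def)
    have shift: "((\<lambda>n. f (Suc n)) has_sum (a - f 0)) UNIV" if "(f has_sum a) UNIV" for f :: "nat \<Rightarrow> real" and a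
    proof -
      have "(f has_sum (a - f 0)) (UNIV - {0})"
        by (intro has_sum_Diff that) (auto intro!: has_sum_finiteI)
      moreover have "UNIV - {0} = range Suc" by (auto simp: image_iff) (metis not0_implies_Suc)
      ultimately show ?thesis by (simp add: has_sum_reindex o_def)
    qed
    have "((\<lambda>n. p (Suc n, E1) * (lam E1 * s (Suc n) + mu E1 + sw E1)) has_sum
             (lam E1 * (J - p (0, E1) * s 0) + (mu E1 + sw E1) * (P E1 - p (0, E1)))) UNIV"
      using has_sum_add[OF has_sum_cmult_right[OF shift[OF J], of "lam E1"]
          has_sum_cmult_right[OF shift[OF P[of E1]], of "mu E1 + sw E1"]]
      by (simp add: algebra_simps)
    moreover have "((\<lambda>n. p (n, E1) * (lam E1 * s n) + p (Suc n, E2) * sw E2) has_sum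
             (lam E1 * J + sw E2 * (P E2 - p (0, E2)))) UNIV"
      using has_sum_add[OF has_sum_cmult_right[OF J, of "lam E1"]
          has_sum_cmult_right[OF shift[OF P[of E2]], of "sw E2"]]
      by (simp add: algebra_simps)
    ultimately have "lam E1 * (J - p (0, E1) * s 0) + (mu E1 + sw E1) * (P E1 - p (0, E1))
        = lam E1 * J + sw E2 * (P E2 - p (0, E2))"
      unfolding eqSuc by (auto intro: has_sum_unique)
    with eq0[of E1] show "sw E1 * P E1 = sw E2 * P E2" by (simp add: algebra_simps)
  qed
  show ?thesis
    unfolding level_equations_def
  proof (intro conjI allI)
    fix n e
    show "(lam e * s 0 + mu e + sw e) * p (0, e) = mu e * p_E M e + sw (other e) * p (0, other e)"
      using eq0[of e] PE[of e] by (simp add: algebra_simps)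
    show "(lam e * s (Suc n) + mu e + sw e) * p (Suc n, e)
            = lam e * s n * p (n, e) + sw (other e) * p (Suc n, other e)"
      using eqSuc[of n e] by (simp add: algebra_simps)
  qed
qed

text \<open>Existence and uniqueness of the stationary distribution are thus both read off from the
recursion: exhibiting any solution of it identifies the definite description in \<open>p_ao\<close>.\<close>

lemma p_ao_eqI:
  assumes eqs: "level_equations s p"
  shows "p_ao M s n e = p n e"
proof -
  have "(THE p. stationary_distr (trans_rate M s) p) = (\<lambda>(n, e). p n e)"
  proof (rule the_equality)
    show "stationary_distr (trans_rate M s) (\<lambda>(n, e). p n e)"
      using level_equations_stationary[OF eqs] .
    show "p' = (\<lambda>(n, e). p n e)" if "stationary_distr (trans_rate M s) p'" for p'
      using level_equations_unique[OF stationary_level_equations[OF that] eqs] by auto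
  qed
  then show ?thesis by (simp add: p_ao_def)
qed

end

section \<open>Explicit solution for the strategies that join whenever someone is present\<close>

text \<open>\<open>rt1\<close> and \<open>rt2\<close> are the ratios of the two geometric sequences that solve the recursion between
successive levels under "always join".\<close>

definition rt1 :: real where "rt1 = 1 / (1 - z1 M)"
definition rt2 :: real where "rt2 = 1 / (1 - z2 M)"

lemma K_pos: "K_const M > 0"
  by (simp add: K_const_def add_pos_pos)

text \<open>The determinant of the matrix with rows \<open>(\<mu>\<^sub>1 + q\<^sub>1\<^sub>2 + \<lambda>\<^sub>1z, -q\<^sub>2\<^sub>1)\<close> and
\<open>(-q\<^sub>1\<^sub>2, \<mu>\<^sub>2 + q\<^sub>2\<^sub>1 + \<lambda>\<^sub>2z)\<close>. A vector \<open>v\<close> in its kernel yields the solution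
\<open>(1 - z)\<^sup>-\<^sup>n v\<close> of the always-join recursion, and \<open>z1\<close>, \<open>z2\<close> are the values for which the kernel is nontrivial.\<close>

definition bal_poly :: "real \<Rightarrow> real" where
  "bal_poly z = lam E1 * lam E2 * z\<^sup>2
     + (lam E1 * (mu E2 + sw E2) + lam E2 * (mu E1 + sw E1)) * z + K_const M"

lemma Delta_pos: "Delta M > 0"
  by (simp add: Delta_def add_nonneg_pos)

lemma Delta_discriminant:
  "Delta M = (lam E1 * (mu E2 + sw E2) + lam E2 * (mu E1 + sw E1))\<^sup>2 - 4 * (lam E1 * lam E2) * K_const M"
  by (simp add: Delta_def K_const_def algebra_simps power2_eq_square)

lemma z_vieta:
  shows "2 * (lam E1 * lam E2) * z1 M
      + (lam E1 * (mu E2 + sw E2) + lam E2 * (mu E1 + sw E1)) = sqrt (Delta M)"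
    and "2 * (lam E1 * lam E2) * z2 M
      + (lam E1 * (mu E2 + sw E2) + lam E2 * (mu E1 + sw E1)) = - sqrt (Delta M)"
proof -
  have "2 * (lam E1 * lam E2) * (v / (2 * lam E1 * lam E2)) = v" for v
    using less_imp_neq[OF rates_pos(1)] by auto
  then show "2 * (lam E1 * lam E2) * z1 M
      + (lam E1 * (mu E2 + sw E2) + lam E2 * (mu E1 + sw E1)) = sqrt (Delta M)"
    and "2 * (lam E1 * lam E2) * z2 M
      + (lam E1 * (mu E2 + sw E2) + lam E2 * (mu E1 + sw E1)) = - sqrt (Delta M)"
    unfolding z1_def z2_def by simp_all
qed

lemma bal_poly_root:
  assumes "2 * (lam E1 * lam E2) * z
      + (lam E1 * (mu E2 + sw E2) + lam E2 * (mu E1 + sw E1)) = h" "h\<^sup>2 = Delta M"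
  shows "bal_poly z = 0"
proof -
  have "4 * (lam E1 * lam E2) * bal_poly z
      = (2 * (lam E1 * lam E2) * z + (lam E1 * (mu E2 + sw E2) + lam E2 * (mu E1 + sw E1)))\<^sup>2
        - Delta M"
    unfolding Delta_discriminant bal_poly_def by (simp add: algebra_simps power2_eq_square)
  also have "\<dots> = 0" using assms by simp
  finally have "4 * (lam E1 * lam E2) * bal_poly z = 0" .
  then show ?thesis using rates_pos(1)[of E1] rates_pos(1)[of E2] by simp
qed

lemma bal_poly_z: "bal_poly (z1 M) = 0" "bal_poly (z2 M) = 0"
  using bal_poly_root[OF z_vieta(1)] bal_poly_root[OF z_vieta(2)] Delta_pos by simp_all

lemma z_diff: "lam E1 * lam E2 * (z1 M - z2 M) = sqrt (Delta M)"
  using z_vieta by (simp add: algebra_simps)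

lemma z_less: "z2 M < z1 M"
proof -
  have "lam E1 * lam E2 * (z1 M - z2 M) > 0" unfolding z_diff using Delta_pos by simp
  moreover have "lam E1 * lam E2 > 0" by simp
  ultimately have "z1 M - z2 M > 0" by (metis zero_less_mult_pos)
  then show ?thesis by simp
qed

lemma z1_neg: "z1 M < 0"
proof -
  let ?b = "lam E1 * (mu E2 + sw E2) + lam E2 * (mu E1 + sw E1)"
  have b: "?b > 0" by (simp add: add_pos_pos)
  have "Delta M < ?b\<^sup>2" unfolding Delta_discriminant using K_pos by simp
  then have "sqrt (Delta M) < ?b" using b by (simp add: real_less_lsqrt)
  with z_vieta(1) have "2 * (lam E1 * lam E2) * z1 M < 0" by linarith
  then have "lam E1 * lam E2 * z1 M < lam E1 * lam E2 * 0" by linarith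
  then show ?thesis by (subst (asm) mult_less_cancel_left_pos) simp_all
qed

lemma rt_bounds: "0 < rt2" "rt2 < rt1" "rt1 < 1"
  using z1_neg z_less by (simp_all add: rt1_def rt2_def field_simps)

lemma coef_numerator:
  assumes "bal_poly z = 0"
  shows "(mu e + sw e + lam e * z) * (mu e * lam (other e) * z + K_const M)
         = sw e * (mu (other e) * lam e * z + K_const M)"
proof -
  have "(mu e + sw e + lam e * z) * (mu e * lam (other e) * z + K_const M)
         - sw e * (mu (other e) * lam e * z + K_const M) = mu e * bal_poly z"
    by (cases e) (simp_all add: bal_poly_def K_const_def algebra_simps power2_eq_square)
  with assms show ?thesis by simp
qed

text \<open>The coefficient vectors \<open>(A\<^sub>1, A\<^sub>2)\<close> and \<open>(B\<^sub>1, B\<^sub>2)\<close> lie in the two kernels.\<close>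

lemma coef_env_relation:
  shows "(mu e + sw e + lam e * z1 M) * coef_A_env M e = sw (other e) * coef_A_env M (other e)"
    and "(mu e + sw e + lam e * z2 M) * coef_B_env M e = sw (other e) * coef_B_env M (other e)"
proof -
  have *: "(mu e + sw e + lam e * z) * ((mu e * lam (other e) * z + K_const M) * p_E M e)
        = sw (other e) * ((mu (other e) * lam e * z + K_const M) * p_E M (other e))"
    if "bal_poly z = 0" for z
    using coef_numerator[OF that, of e] p_E_balance[of e] by algebra
  show "(mu e + sw e + lam e * z1 M) * coef_A_env M e = sw (other e) * coef_A_env M (other e)"
    using *[OF bal_poly_z(1)] by (simp add: coef_A_env_def)
  show "(mu e + sw e + lam e * z2 M) * coef_B_env M e = sw (other e) * coef_B_env M (other e)"
    using *[OF bal_poly_z(2)] by (simp add: coef_B_env_def)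
qed

text \<open>This normalisation makes the combination of the two geometric solutions satisfy the equation
of level \<open>0\<close>.\<close>

lemma coef_env_initial:
  "lam e * (coef_A_env M e / rt1 + coef_B_env M e / rt2) = mu e * p_E M e"
proof -
  have h: "sqrt (Delta M) > 0" and d: "1 - z1 M > 0" "1 - z2 M > 0"
    using Delta_pos z1_neg z_less by simp_all
  have A: "coef_A_env M e / rt1 = (mu e * lam (other e) * z1 M + K_const M) * p_E M e / sqrt (Delta M)"
    using d by (simp add: coef_A_env_def rt1_def)
  have B: "coef_B_env M e / rt2 = - ((mu e * lam (other e) * z2 M + K_const M) * p_E M e / sqrt (Delta M))"
    using d by (simp add: coef_B_env_def rt2_def)
  have "lam e * (coef_A_env M e / rt1 + coef_B_env M e / rt2)
      = mu e * p_E M e * (lam e * lam (other e) * (z1 M - z2 M)) / sqrt (Delta M)"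
    unfolding A B by (simp add: divide_inverse algebra_simps)
  also have "lam e * lam (other e) * (z1 M - z2 M) = sqrt (Delta M)"
    using z_diff by (cases e) (simp_all add: mult.commute)
  finally show ?thesis using h by simp
qed

lemma coef_env_step:
  shows "(lam e + mu e + sw e) * coef_A_env M e
           = lam e * (coef_A_env M e / rt1) + sw (other e) * coef_A_env M (other e)"
    and "(lam e + mu e + sw e) * coef_B_env M e
           = lam e * (coef_B_env M e / rt2) + sw (other e) * coef_B_env M (other e)"
  using coef_env_relation[of e] by (simp_all add: rt1_def rt2_def algebra_simps)

text \<open>The value of \<open>\<Sum>\<^bsub>i\<ge>n\<^esub> (1 - \<theta>)\<^bsup>i-n\<^esup> r\<^sup>i\<close>, in closed form so that it can be used without
convergence arguments.\<close>

definition thinned_tail :: "real \<Rightarrow> nat \<Rightarrow> real \<Rightarrow> real" where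
  "thinned_tail r n \<theta> = r ^ n / (1 - r * (1 - \<theta>))"

abbreviation "mode1 \<equiv> thinned_tail rt1"
abbreviation "mode2 \<equiv> thinned_tail rt2"

lemma mode_denom:
  assumes "0 \<le> \<theta>" "\<theta> \<le> 1"
  shows "1 - rt1 * (1 - \<theta>) > 0" "1 - rt2 * (1 - \<theta>) > 0"
proof -
  have *: "1 - r * (1 - \<theta>) > 0" if "0 < r" "r < 1" for r
  proof -
    have "r * (1 - \<theta>) \<le> r * 1" using that assms by (intro mult_left_mono) auto
    with that show ?thesis by linarith
  qed
  show "1 - rt1 * (1 - \<theta>) > 0" "1 - rt2 * (1 - \<theta>) > 0"
    using * rt_bounds by auto
qed

text \<open>Let everybody who balks at an empty facility be counted as well: the number of arrivals since
the last visit then evolves as under "always join", with distribution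
\<open>u\<^sub>i(e) = A\<^sub>e rt1\<^sup>i + B\<^sub>e rt2\<^sup>i\<close>. If customers join an empty facility with probability \<open>\<theta>\<close> and a
nonempty one always, then after \<open>i\<close> arrivals the facility is still empty with probability
\<open>(1 - \<theta>)\<^sup>i\<close>, and it holds \<open>n \<ge> 1\<close> customers if the first \<open>i - n\<close> arrivals balked and the next one
joined, with probability \<open>(1 - \<theta>)\<^bsup>i-n\<^esup> \<theta>\<close>. Summing over \<open>i\<close> gives the formula below; that it
satisfies the level equations is then a calculation.\<close>

definition p_rt :: "real \<Rightarrow> nat \<Rightarrow> env \<Rightarrow> real" where
  "p_rt \<theta> n e = (if n = 0 then 1 else \<theta>) *
     (coef_A_env M e * mode1 n \<theta> + coef_B_env M e * mode2 n \<theta>)"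

lemma p_rt_level_0:
  assumes \<theta>: "0 \<le> \<theta>" "\<theta> \<le> 1"
  shows "((lam e * \<theta> + mu e) + sw e) * p_rt \<theta> 0 e = mu e * p_E M e + sw (other e) * p_rt \<theta> 0 (other e)"
proof -
  note d = mode_denom[OF \<theta>]
  have r: "rt1 > 0" "rt2 > 0" using rt_bounds by auto
  have mode: "(lam e * \<theta> + mu e + sw e) * (a e * (1 / (1 - r * (1 - \<theta>))))
      = lam e * (a e / r) + sw (other e) * (a (other e) * (1 / (1 - r * (1 - \<theta>))))"
    if "(lam e + mu e + sw e) * a e = lam e * (a e / r) + sw (other e) * a (other e)"
      "1 - r * (1 - \<theta>) > 0" "r > 0" for a r
  proof -
    have "(lam e * \<theta> + mu e + sw e) * a e = (lam e + mu e + sw e) * a e - lam e * (1 - \<theta>) * a e"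
      by (simp add: algebra_simps)
    also have "\<dots> = lam e * (a e / r) * (1 - r * (1 - \<theta>)) + sw (other e) * a (other e)"
      unfolding that(1) using that(3) by (simp add: field_simps)
    finally have "(lam e * \<theta> + mu e + sw e) * a e * (1 / (1 - r * (1 - \<theta>)))
      = (lam e * (a e / r) * (1 - r * (1 - \<theta>)) + sw (other e) * a (other e)) * (1 / (1 - r * (1 - \<theta>)))"
      by simp
    also have "\<dots> = lam e * (a e / r) + sw (other e) * (a (other e) * (1 / (1 - r * (1 - \<theta>))))"
      using that(2) by (simp add: add_divide_distrib)
    finally show ?thesis by (simp add: mult.assoc)
  qed
  show ?thesis
    using mode[OF coef_env_step(1) d(1) r(1)] mode[OF coef_env_step(2) d(2) r(2)] coef_env_initial[of e]
    by (simp add: p_rt_def thinned_tail_def distrib_left)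
qed

lemma p_rt_mode_step:
  "(lam e + mu e + sw e) * (coef_A_env M e * mode1 (Suc n) \<theta> + coef_B_env M e * mode2 (Suc n) \<theta>)
    = lam e * (coef_A_env M e * mode1 n \<theta> + coef_B_env M e * mode2 n \<theta>)
      + sw (other e) * (coef_A_env M (other e) * mode1 (Suc n) \<theta> + coef_B_env M (other e) * mode2 (Suc n) \<theta>)"
proof -
  have r: "rt1 > 0" "rt2 > 0" using rt_bounds by auto
  have m: "mode1 n \<theta> = mode1 (Suc n) \<theta> / rt1" "mode2 n \<theta> = mode2 (Suc n) \<theta> / rt2"
    using r by (simp_all add: thinned_tail_def)
  show ?thesis
    using arg_cong[OF coef_env_step(1)[of e], of "\<lambda>x. x * mode1 (Suc n) \<theta>"]
      arg_cong[OF coef_env_step(2)[of e], of "\<lambda>x. x * mode2 (Suc n) \<theta>"]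
    unfolding m by (simp add: algebra_simps)
qed

text \<open>For \<open>\<theta> = 0\<close> all mass sits on the empty state, and every level \<open>n \<ge> 1\<close> reads \<open>0 = 0\<close> whatever
\<open>s\<close> prescribes there. Separating this case lets the lemma cover \<open>always_balk\<close>.\<close>

lemma level_equations_p_rt:
  assumes \<theta>: "0 \<le> \<theta>" "\<theta> \<le> 1" and s0: "s 0 = \<theta>" and s1: "\<theta> = 0 \<or> (\<forall>n\<ge>1. s n = 1)"
  shows "level_equations s (p_rt \<theta>)"
  unfolding level_equations_def
proof (intro conjI allI)
  fix n e
  show "((lam e * s 0 + mu e) + sw e) * p_rt \<theta> 0 e
          = mu e * p_E M e + sw (other e) * p_rt \<theta> 0 (other e)"
    using p_rt_level_0[OF \<theta>] by (simp add: s0)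
  show "((lam e * s (Suc n) + mu e) + sw e) * p_rt \<theta> (Suc n) e
          = lam e * s n * p_rt \<theta> n e + sw (other e) * p_rt \<theta> (Suc n) (other e)"
  proof (cases "\<theta> = 0")
    case True
    with s0 show ?thesis by (cases n) (simp_all add: p_rt_def)
  next
    case False
    with s1 have s: "s (Suc n) = 1"
      and sn: "s n * p_rt \<theta> n e = \<theta> * (coef_A_env M e * mode1 n \<theta> + coef_B_env M e * mode2 n \<theta>)"
      by (auto simp: s0 p_rt_def)
    have "lam e * s n * p_rt \<theta> n e
        = lam e * (\<theta> * (coef_A_env M e * mode1 n \<theta> + coef_B_env M e * mode2 n \<theta>))"
      by (simp only: sn mult.assoc)
    with s show ?thesis
      using arg_cong[OF p_rt_mode_step[of e n \<theta>], of "\<lambda>x. \<theta> * x"]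
      by (simp add: p_rt_def algebra_simps)
  qed
qed

text \<open>Summing the geometric series shows that \<open>F_fun\<close> and \<open>G_fun\<close> are combinations of the same two
modes as the stationary distribution.\<close>

lemma thinned_sum:
  assumes \<theta>: "0 \<le> \<theta>" "\<theta> \<le> 1"
  shows "(\<Sum>\<^sub>\<infinity>i\<in>{n..}. (1 - \<theta>) ^ (i - n) * (a * rt1 ^ i + b * rt2 ^ i))
         = a * mode1 n \<theta> + b * mode2 n \<theta>"
proof -
  have geo: "((\<lambda>k. r ^ n * ((r * (1 - \<theta>)) ^ k)) has_sum (r ^ n / (1 - r * (1 - \<theta>)))) UNIV"
    if "0 < r" "r < 1" "1 - r * (1 - \<theta>) > 0" for r
  proof -
    have "norm (r * (1 - \<theta>)) < 1" using that \<theta> by simp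
    from geometric_sums[OF this]
    have "((\<lambda>k. (r * (1 - \<theta>)) ^ k) has_sum (1 / (1 - r * (1 - \<theta>)))) UNIV"
      by (rule sums_nonneg_imp_has_sum) (use that \<theta> in auto)
    from has_sum_cmult_right[OF this, of "r ^ n"] show ?thesis by simp
  qed
  have "((\<lambda>k. a * (rt1 ^ n * ((rt1 * (1 - \<theta>)) ^ k)) + b * (rt2 ^ n * ((rt2 * (1 - \<theta>)) ^ k)))
           has_sum (a * mode1 n \<theta> + b * mode2 n \<theta>)) UNIV"
    unfolding thinned_tail_def
    by (intro has_sum_add has_sum_cmult_right geo) (use rt_bounds mode_denom[OF \<theta>] in auto)
  moreover have "{n..} = (\<lambda>k. k + n) ` UNIV"
    by (auto simp: image_iff) (metis le_add_diff_inverse2)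
  moreover have "a * (rt1 ^ n * ((rt1 * (1 - \<theta>)) ^ k)) + b * (rt2 ^ n * ((rt2 * (1 - \<theta>)) ^ k))
      = (1 - \<theta>) ^ k * (a * rt1 ^ (k + n) + b * rt2 ^ (k + n))" for k
    unfolding power_add power_mult_distrib by (simp add: distrib_left mult_ac)
  ultimately have "((\<lambda>i. (1 - \<theta>) ^ (i - n) * (a * rt1 ^ i + b * rt2 ^ i))
           has_sum (a * mode1 n \<theta> + b * mode2 n \<theta>)) {n..}"
    by (simp add: has_sum_reindex o_def)
  then show ?thesis by (rule infsumI)
qed

abbreviation "net1 \<equiv> reward M * coef_D M - cost M * coef_A M"
abbreviation "net2 \<equiv> reward M * coef_E M - cost M * coef_B M"

lemma F_fun_closed:
  assumes "0 \<le> \<theta>" "\<theta> \<le> 1"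
  shows "F_fun M n \<theta> = net1 * mode1 n \<theta> + net2 * mode2 n \<theta>"
  using thinned_sum[OF assms] by (simp add: F_fun_def rt1_def rt2_def)

lemma G_fun_closed:
  assumes "0 \<le> \<theta>" "\<theta> \<le> 1"
  shows "G_fun M n \<theta> = coef_D M * mode1 n \<theta> + coef_E M * mode2 n \<theta>"
  using thinned_sum[OF assms] by (simp add: G_fun_def rt1_def rt2_def)

section \<open>Equilibria as pointwise sign conditions\<close>

text \<open>The benefit \<open>S_ao\<close> multiplied by the arrival weight. It has the sign of \<open>S_ao\<close> where the
weight is positive and vanishes elsewhere, so no division has to be guarded.\<close>

definition net_gain :: "strat \<Rightarrow> nat \<Rightarrow> real" where
  "net_gain s n = (reward M - cost M * mean_visit_time M E1) * (lam E1 * p_ao M s n E1)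
                + (reward M - cost M * mean_visit_time M E2) * (lam E2 * p_ao M s n E2)"

lemma mean_visit_time_nonneg: "mean_visit_time M e \<ge> 0"
  using K_pos by (simp add: mean_visit_time_def add_nonneg_nonneg)

context
  fixes s p
  assumes s: "s \<in> strategies" and eqs: "level_equations s p"
begin

lemma p_ao_eq: "p_ao M s = p"
  using p_ao_eqI[OF s eqs] by (intro ext)

lemma arr_weight_eq: "arr_weight M s n = lam E1 * p n E1 + lam E2 * p n E2"
  by (simp add: arr_weight_def p_ao_eq)

lemma arr_weight_total_pos: "(\<Sum>\<^sub>\<infinity>n. arr_weight M s n) > 0"
proof -
  have "((\<lambda>n. arr_weight M s n) has_sum (lam E1 * p_E M E1 + lam E2 * p_E M E2)) UNIV"
    unfolding arr_weight_eq
    by (intro has_sum_add has_sum_cmult_right level_equations_marginal[OF s eqs])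
  then have "(\<Sum>\<^sub>\<infinity>n. arr_weight M s n) = lam E1 * p_E M E1 + lam E2 * p_E M E2"
    by (rule infsumI)
  then show ?thesis using p_E_pos by (simp add: add_pos_pos)
qed

lemma arr_prob_pos_iff: "arr_prob M s n > 0 \<longleftrightarrow> arr_weight M s n > 0"
  using arr_weight_total_pos by (simp add: arr_prob_def zero_less_divide_iff)

lemma net_gain_zero_weight:
  assumes "\<not> arr_weight M s n > 0"
  shows "net_gain s n = 0"
proof -
  have "lam E1 * p n E1 \<ge> 0" "lam E2 * p n E2 \<ge> 0"
    using level_equations_nonneg[OF s eqs] by simp_all
  with assms have "lam E1 * p n E1 = 0" "lam E2 * p n E2 = 0"
    unfolding arr_weight_eq by linarith+
  then show ?thesis unfolding net_gain_def p_ao_eq by (simp only: mult_zero_right add_0_right)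
qed

lemma net_gain_summable:
  assumes "s' \<in> strategies"
  shows "(\<lambda>n. net_gain s n * s' n) summable_on UNIV"
proof -
  have "((\<lambda>n. net_gain s n) has_sum
      (reward M - cost M * mean_visit_time M E1) * (lam E1 * p_E M E1)
      + (reward M - cost M * mean_visit_time M E2) * (lam E2 * p_E M E2)) UNIV"
    unfolding net_gain_def p_ao_eq
    by (intro has_sum_add has_sum_cmult_right level_equations_marginal[OF s eqs])
  then have "(\<lambda>n. net_gain s n) summable_on UNIV"
    by (rule has_sum_imp_summable)
  then have abs: "(\<lambda>n. norm (net_gain s n)) summable_on UNIV"
    by (rule summable_on_iff_abs_summable_on_real[THEN iffD1])
  have le: "norm (net_gain s n * s' n) \<le> norm (net_gain s n)" for n
    using strategy_bounds[OF assms, of n] by (simp add: abs_mult mult_left_le)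
  show ?thesis
    by (rule abs_summable_summable, rule Infinite_Sum.abs_summable_on_comparison_test[OF abs], rule le)
qed

lemma payoff_eq:
  "payoff M s' s = (\<Sum>\<^sub>\<infinity>n. net_gain s n * s' n) / (\<Sum>\<^sub>\<infinity>n. arr_weight M s n)"
proof -
  let ?W = "\<Sum>\<^sub>\<infinity>n. arr_weight M s n"
  have "payoff M s' s = (\<Sum>\<^sub>\<infinity>n. inverse ?W * (net_gain s n * s' n))"
    unfolding payoff_def
  proof (rule infsum_cong_neutral)
    fix n assume "n \<in> {n. 0 < arr_prob M s n} \<inter> UNIV"
    then have "arr_weight M s n > 0" using arr_prob_pos_iff by auto
    then have "arr_weight M s n * S_ao M s n = net_gain s n"
      by (simp add: S_ao_def net_gain_def field_simps) (simp add: arr_weight_def algebra_simps)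
    then show "arr_prob M s n * s' n * S_ao M s n = inverse ?W * (net_gain s n * s' n)"
      by (simp add: arr_prob_def divide_inverse mult_ac)
  next
    fix n assume "n \<in> UNIV - {n. 0 < arr_prob M s n}"
    then show "inverse ?W * (net_gain s n * s' n) = 0"
      using net_gain_zero_weight arr_prob_pos_iff by simp
  qed auto
  then show ?thesis by (simp add: infsum_cmult_right' divide_inverse mult.commute)
qed

text \<open>The payoff of a deviation is linear in each coordinate of the deviation with slope
proportional to \<open>net_gain s n\<close>; hence \<open>s\<close> is a best response to itself iff each coordinate is
optimal on its own.\<close>

lemma equilibrium_iff:
  "equilibrium M s \<longleftrightarrow> (\<forall>n. (net_gain s n > 0 \<longrightarrow> s n = 1) \<and> (net_gain s n < 0 \<longrightarrow> s n = 0))"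
proof
  assume eq: "equilibrium M s"
  show "\<forall>n. (net_gain s n > 0 \<longrightarrow> s n = 1) \<and> (net_gain s n < 0 \<longrightarrow> s n = 0)"
  proof (rule ccontr)
    assume "\<not> ?thesis"
    then obtain n where n: "(net_gain s n > 0 \<and> s n \<noteq> 1) \<or> (net_gain s n < 0 \<and> s n \<noteq> 0)" by auto
    \<comment> \<open>Correcting \<open>s\<close> at the single queue length \<open>n\<close> is a profitable deviation.\<close>
    define s' where "s' = s(n := if net_gain s n > 0 then 1 else 0)"
    have s': "s' \<in> strategies" using s by (auto simp: s'_def strategies_def)
    have "net_gain s n * s n < net_gain s n * s' n"
      using n strategy_bounds[OF s, of n] by (auto simp: s'_def mult_less_0_iff)
    then have "(\<Sum>\<^sub>\<infinity>n. net_gain s n * s n) < (\<Sum>\<^sub>\<infinity>n. net_gain s n * s' n)"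
      by (intro has_sum_strict_mono[OF has_sum_infsum has_sum_infsum, of _ UNIV _ n]
          net_gain_summable s s') (auto simp: s'_def)
    then have "payoff M s s < payoff M s' s"
      unfolding payoff_eq using arr_weight_total_pos by (simp add: divide_strict_right_mono)
    moreover have "payoff M s' s \<le> payoff M s s"
      using eq s' by (simp add: equilibrium_def)
    ultimately show False by simp
  qed
next
  assume opt: "\<forall>n. (net_gain s n > 0 \<longrightarrow> s n = 1) \<and> (net_gain s n < 0 \<longrightarrow> s n = 0)"
  show "equilibrium M s"
    unfolding equilibrium_def
  proof (intro conjI ballI s)
    fix s' assume s': "s' \<in> strategies"
    have "net_gain s n * s' n \<le> net_gain s n * s n" for n
    proof (cases "net_gain s n" "0 :: real" rule: linorder_cases)
      case less
      with opt strategy_bounds[OF s', of n] show ?thesis by (simp add: mult_nonpos_nonneg)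
    next
      case greater
      with opt strategy_bounds[OF s', of n] show ?thesis by (simp add: mult_left_le)
    qed simp
    then have "(\<Sum>\<^sub>\<infinity>n. net_gain s n * s' n) \<le> (\<Sum>\<^sub>\<infinity>n. net_gain s n * s n)"
      by (intro infsum_mono net_gain_summable s s')
    then show "payoff M s' s \<le> payoff M s s"
      unfolding payoff_eq using arr_weight_total_pos by (simp add: divide_right_mono)
  qed
qed

end

section \<open>The equilibrium condition in terms of F\<close>

lemma always_balk_strategy: "always_balk \<in> strategies"
  by (auto simp: always_balk_def strategies_def)

lemma rev_threshold_strategy: "0 \<le> \<theta> \<Longrightarrow> \<theta> \<le> 1 \<Longrightarrow> rev_threshold 0 \<theta> \<in> strategies"
  by (auto simp: rev_threshold_def strategies_def)

lemma level_equations_rev_threshold: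
  "0 \<le> \<theta> \<Longrightarrow> \<theta> \<le> 1 \<Longrightarrow> level_equations (rev_threshold 0 \<theta>) (p_rt \<theta>)"
  by (rule level_equations_p_rt) (auto simp: rev_threshold_def)

lemma level_equations_always_balk: "level_equations always_balk (p_rt 0)"
  by (rule level_equations_p_rt) (auto simp: always_balk_def)

text \<open>Averaging the stationary weights over the environment turns \<open>p_rt\<close> into \<open>G_fun\<close> (arrival
weight) and \<open>F_fun\<close> (net gain).\<close>

lemma G_fun_p_rt:
  assumes "0 \<le> \<theta>" "\<theta> \<le> 1"
  shows "lam E1 * p_rt \<theta> n E1 + lam E2 * p_rt \<theta> n E2 = (if n = 0 then 1 else \<theta>) * G_fun M n \<theta>"
  using assms by (simp add: G_fun_closed p_rt_def coef_D_def coef_E_def algebra_simps)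

lemma F_fun_p_rt:
  assumes "0 \<le> \<theta>" "\<theta> \<le> 1"
  shows "(reward M - cost M * mean_visit_time M E1) * (lam E1 * p_rt \<theta> n E1)
       + (reward M - cost M * mean_visit_time M E2) * (lam E2 * p_rt \<theta> n E2)
       = (if n = 0 then 1 else \<theta>) * F_fun M n \<theta>"
  using assms
  by (simp add: F_fun_closed p_rt_def coef_A_def coef_B_def coef_D_def coef_E_def algebra_simps)

text \<open>Positivity cannot be read off the closed form; it is inherited from the stationary
distribution.\<close>

lemma G_fun_pos_0:
  assumes "0 \<le> \<theta>" "\<theta> \<le> 1"
  shows "G_fun M 0 \<theta> > 0"
proof -
  have "p_rt \<theta> 0 e > 0" for e
    by (rule level_equations_pos_0[OF rev_threshold_strategy level_equations_rev_threshold])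
      (rule assms)+
  then have "lam E1 * p_rt \<theta> 0 E1 + lam E2 * p_rt \<theta> 0 E2 > 0" by (simp add: add_pos_pos)
  then show ?thesis using G_fun_p_rt[OF assms, of 0] by simp
qed

lemma G_fun_pos:
  assumes "0 < \<theta>" "\<theta> \<le> 1"
  shows "G_fun M n \<theta> > 0"
proof -
  have "p_rt \<theta> n e > 0" for e
    by (rule level_equations_pos[OF rev_threshold_strategy level_equations_rev_threshold])
      (use assms in \<open>auto simp: rev_threshold_def\<close>)
  then have "lam E1 * p_rt \<theta> n E1 + lam E2 * p_rt \<theta> n E2 > 0" by (simp add: add_pos_pos)
  then show ?thesis using G_fun_p_rt[of \<theta> n] assms by (simp add: zero_less_mult_iff split: if_splits)
qed

lemma net_gain_rev_threshold:
  assumes "0 \<le> \<theta>" "\<theta> \<le> 1"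
  shows "net_gain (rev_threshold 0 \<theta>) n = (if n = 0 then 1 else \<theta>) * F_fun M n \<theta>"
  unfolding net_gain_def
    p_ao_eq[OF rev_threshold_strategy[OF assms] level_equations_rev_threshold[OF assms]]
  by (rule F_fun_p_rt[OF assms])

lemma net_gain_always_balk: "net_gain always_balk n = (if n = 0 then F_fun M 0 0 else 0)"
  unfolding net_gain_def p_ao_eq[OF always_balk_strategy level_equations_always_balk]
  by (subst F_fun_p_rt) auto

lemma equilibrium_always_balk: "equilibrium M always_balk \<longleftrightarrow> F_fun M 0 0 \<le> 0"
  unfolding equilibrium_iff[OF always_balk_strategy level_equations_always_balk]
    net_gain_always_balk
  by (auto simp: always_balk_def not_less)

lemma F_fun_le: "F_fun M n 1 \<le> reward M * G_fun M n 1"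
proof -
  have nn: "p_rt 1 n e \<ge> 0" for e
    using level_equations_nonneg[OF rev_threshold_strategy level_equations_rev_threshold, of 1] by simp
  have "(reward M - cost M * mean_visit_time M e) * (lam e * p_rt 1 n e) \<le> reward M * (lam e * p_rt 1 n e)" for e
    using nn mean_visit_time_nonneg[of e] by (intro mult_right_mono) (auto simp: less_imp_le)
  from add_mono[OF this[of E1] this[of E2]] show ?thesis
    using F_fun_p_rt[of 1 n] G_fun_p_rt[of 1 n] by (simp flip: distrib_left)
qed

section \<open>Monotonicity of F/G\<close>

lemma coef_env_det:
  "(coef_A_env M E1 * coef_B_env M E2 - coef_A_env M E2 * coef_B_env M E1)
     * (Delta M * (1 - z1 M) * (1 - z2 M))
   = p_E M E1 * p_E M E2 * K_const M * (mu E2 * lam E1 - mu E1 * lam E2) * (z1 M - z2 M)"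
proof -
  define h where h_def: "h = sqrt (Delta M)"
  have h: "h > 0" "Delta M = h * h" and d: "1 - z1 M > 0" "1 - z2 M > 0"
    using Delta_pos z1_neg z_less by (simp_all add: h_def)
  have A: "coef_A_env M e * (h * (1 - z1 M)) = (mu e * lam (other e) * z1 M + K_const M) * p_E M e" for e
    using h(1) d by (simp add: coef_A_env_def flip: h_def)
  have B: "coef_B_env M e * (h * (1 - z2 M)) = - ((mu e * lam (other e) * z2 M + K_const M) * p_E M e)" for e
    using h(1) d by (simp add: coef_B_env_def flip: h_def)
  have "(coef_A_env M E1 * coef_B_env M E2 - coef_A_env M E2 * coef_B_env M E1)
     * (Delta M * (1 - z1 M) * (1 - z2 M))
     = (coef_A_env M E1 * (h * (1 - z1 M))) * (coef_B_env M E2 * (h * (1 - z2 M)))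
     - (coef_A_env M E2 * (h * (1 - z1 M))) * (coef_B_env M E1 * (h * (1 - z2 M)))"
    unfolding h(2) by (simp add: algebra_simps)
  also have "\<dots> = p_E M E1 * p_E M E2 * K_const M * (mu E2 * lam E1 - mu E1 * lam E2) * (z1 M - z2 M)"
    unfolding A B by (simp add: algebra_simps)
  finally show ?thesis .
qed

text \<open>The determinant formed by the coefficients of \<open>F_fun\<close> and \<open>G_fun\<close> in the two modes; its sign
decides in which direction \<open>F/G\<close> varies.\<close>

definition mode_det :: real where
  "mode_det = net1 * coef_E M - net2 * coef_D M"

lemma mode_det_eq:
  "mode_det = cost M * (lam E1 * lam E2) * (mean_visit_time M E2 - mean_visit_time M E1)
     * (coef_A_env M E1 * coef_B_env M E2 - coef_A_env M E2 * coef_B_env M E1)"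
  by (simp add: mode_det_def coef_A_def coef_B_def coef_D_def coef_E_def algebra_simps)

text \<open>The reward cancels from the determinant, which becomes a positive multiple of
\<open>(T\<^sub>2 - T\<^sub>1)(A\<^sub>1B\<^sub>2 - A\<^sub>2B\<^sub>1)\<close>. The first factor has the sign of \<open>\<mu>\<^sub>1 - \<mu>\<^sub>2\<close> and the second the
sign of \<open>\<rho>\<^sub>1 - \<rho>\<^sub>2\<close>.\<close>

lemma mode_det_pos:
  assumes "(mu E1 - mu E2) * (rho M E1 - rho M E2) > 0"
  shows "mode_det > 0"
proof -
  let ?X = "coef_A_env M E1 * coef_B_env M E2 - coef_A_env M E2 * coef_B_env M E1"
  have d: "Delta M * (1 - z1 M) * (1 - z2 M) > 0"
    using Delta_pos z1_neg z_less by (intro mult_pos_pos) auto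
  have rho: "(rho M E1 - rho M E2) * (mu E1 * mu E2) = mu E2 * lam E1 - mu E1 * lam E2"
    using less_imp_neq[OF rates_pos(2)[of E1]] less_imp_neq[OF rates_pos(2)[of E2]]
    by (simp add: rho_def algebra_simps)
  have T: "(mean_visit_time M E2 - mean_visit_time M E1) * K_const M = mu E1 - mu E2"
    using K_pos by (simp add: mean_visit_time_def field_simps)
  have "(mean_visit_time M E2 - mean_visit_time M E1) * K_const M * (?X * (Delta M * (1 - z1 M) * (1 - z2 M)))
      = ((mu E1 - mu E2) * (rho M E1 - rho M E2))
        * (mu E1 * mu E2 * p_E M E1 * p_E M E2 * K_const M * (z1 M - z2 M))"
    unfolding T coef_env_det rho[symmetric] by (simp add: algebra_simps)
  also have "\<dots> > 0"
    using z_less K_pos p_E_pos by (intro mult_pos_pos[OF assms], intro mult_pos_pos) auto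
  finally have "((mean_visit_time M E2 - mean_visit_time M E1) * ?X)
      * (K_const M * (Delta M * (1 - z1 M) * (1 - z2 M))) > 0"
    by (simp add: mult_ac)
  then have "(mean_visit_time M E2 - mean_visit_time M E1) * ?X > 0"
    using mult_pos_pos[OF K_pos d] zero_less_mult_pos2 by blast
  from mult_pos_pos[OF _ this, of "cost M * (lam E1 * lam E2)"] show ?thesis
    unfolding mode_det_eq by (simp add: mult.assoc)
qed

text \<open>Two functions that are combinations of the same two modes: their cross difference factors into
a coefficient determinant and a mode determinant, at any two arguments.\<close>

lemma F_G_cross:
  assumes "0 \<le> \<theta>" "\<theta> \<le> 1" "0 \<le> \<theta>'" "\<theta>' \<le> 1"
  shows "F_fun M n \<theta> * G_fun M n' \<theta>' - F_fun M n' \<theta>' * G_fun M n \<theta>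
         = mode_det * (mode1 n \<theta> * mode2 n' \<theta>' - mode1 n' \<theta>' * mode2 n \<theta>)"
  using assms by (simp add: F_fun_closed G_fun_closed mode_det_def algebra_simps)

lemma mode_ratio_mono_n:
  assumes "0 \<le> \<theta>" "\<theta> \<le> 1" "n < m"
  shows "mode1 n \<theta> * mode2 m \<theta> < mode1 m \<theta> * mode2 n \<theta>"
proof -
  obtain k where m: "m = n + k" "k > 0" using assms(3) less_imp_add_positive by blast
  have "rt2 ^ k < rt1 ^ k" using rt_bounds m(2) by (intro power_strict_mono) auto
  then have "rt1 ^ n * rt2 ^ n * rt2 ^ k < rt1 ^ n * rt2 ^ n * rt1 ^ k"
    using rt_bounds by (intro mult_strict_left_mono) auto
  then have "rt1 ^ n * rt2 ^ m < rt1 ^ m * rt2 ^ n" by (simp add: m power_add mult_ac)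
  then show ?thesis
    using mode_denom[OF assms(1,2)] by (simp add: thinned_tail_def divide_strict_right_mono)
qed

text \<open>Raising \<open>\<theta>\<close> discounts long runs of balking more heavily, which hurts the slowly decaying first
mode most.\<close>

lemma mode_ratio_antimono_theta:
  assumes "0 \<le> \<theta>" "\<theta> < \<theta>'" "\<theta>' \<le> 1"
  shows "mode1 0 \<theta>' * mode2 0 \<theta> < mode1 0 \<theta> * mode2 0 \<theta>'"
proof -
  have "(rt1 - rt2) * (\<theta>' - \<theta>) > 0" using rt_bounds assms by simp
  then have "(1 - rt1 * (1 - \<theta>)) * (1 - rt2 * (1 - \<theta>')) < (1 - rt1 * (1 - \<theta>')) * (1 - rt2 * (1 - \<theta>))"
    by (simp add: algebra_simps)
  moreover have "(1 - rt1 * (1 - \<theta>)) * (1 - rt2 * (1 - \<theta>')) > 0"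
    using assms mode_denom[of \<theta>] mode_denom[of \<theta>'] by simp
  ultimately show ?thesis
    unfolding thinned_tail_def by (simp add: frac_less2 mult_ac)
qed

end

locale clearing_reverse = clearing +
  assumes reverse: "(mu E1 - mu E2) * (rho M E1 - rho M E2) > 0"
begin

lemma F_G_mono_n:
  assumes "0 \<le> \<theta>" "\<theta> \<le> 1" "n < m"
  shows "F_fun M n \<theta> * G_fun M m \<theta> < F_fun M m \<theta> * G_fun M n \<theta>"
  using F_G_cross[of \<theta> \<theta> m n] mult_pos_pos[OF mode_det_pos[OF reverse]] mode_ratio_mono_n[OF assms] assms
  by (smt (verit))

text \<open>Since \<open>F/G\<close> increases in \<open>n\<close>, joining pays at every longer queue once it is not harmful at \<open>n\<close>.\<close>

lemma F_fun_pos_larger_n: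
  assumes "0 < \<theta>" "\<theta> \<le> 1" "n < m" "F_fun M n \<theta> \<ge> 0"
  shows "F_fun M m \<theta> > 0"
proof -
  have "0 \<le> F_fun M n \<theta> * G_fun M m \<theta>" using assms G_fun_pos[of \<theta> m] by simp
  with F_G_mono_n[of \<theta> n m] assms have "0 < F_fun M m \<theta> * G_fun M n \<theta>" by linarith
  then show ?thesis using G_fun_pos[of \<theta> n] assms zero_less_mult_pos2 by blast
qed

text \<open>An avoid-the-crowd effect: \<open>F(0,\<theta>)/G(0,\<theta>)\<close> strictly decreases in \<open>\<theta>\<close>. The fewer
customers join an empty facility, the more unseen arrivals an empty facility may conceal, and the
better news it is. This is what makes the equilibrium unique.\<close>

lemma F_fun_pos_smaller_theta:
  assumes "0 \<le> \<theta>" "\<theta> < \<theta>'" "\<theta>' \<le> 1" "F_fun M 0 \<theta>' \<ge> 0"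
  shows "F_fun M 0 \<theta> > 0"
proof -
  have "0 < mode_det * (mode1 0 \<theta> * mode2 0 \<theta>' - mode1 0 \<theta>' * mode2 0 \<theta>)"
    using mode_ratio_antimono_theta[OF assms(1-3)] by (intro mult_pos_pos mode_det_pos[OF reverse]) simp
  then have "F_fun M 0 \<theta>' * G_fun M 0 \<theta> < F_fun M 0 \<theta> * G_fun M 0 \<theta>'"
    using F_G_cross[of \<theta> \<theta>' 0 0] assms by simp
  moreover have "0 \<le> F_fun M 0 \<theta>' * G_fun M 0 \<theta>"
    using assms G_fun_pos_0[of \<theta>] by simp
  ultimately have "0 < F_fun M 0 \<theta> * G_fun M 0 \<theta>'" by linarith
  then show ?thesis using G_fun_pos_0[of \<theta>'] assms zero_less_mult_pos2 by force
qed

section \<open>Classification of the equilibria\<close>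

lemma F_fun_root:
  assumes "F_fun M 0 1 < 0" "F_fun M 0 0 > 0"
  shows "\<exists>!\<theta>. \<theta> \<in> {0<..<1} \<and> F_fun M 0 \<theta> = 0"
proof -
  have "continuous_on {0..1} (\<lambda>\<theta>. net1 * mode1 0 \<theta> + net2 * mode2 0 \<theta>)"
    unfolding thinned_tail_def
    by (intro continuous_intros) (use mode_denom in \<open>force+\<close>)
  then have "continuous_on {0..1} (F_fun M 0)"
    by (subst continuous_on_cong[OF refl F_fun_closed]) auto
  then obtain \<theta> where \<theta>: "0 \<le> \<theta>" "\<theta> \<le> 1" "F_fun M 0 \<theta> = 0"
    using IVT2'[of "F_fun M 0" 1 0 0] assms by auto
  with assms have "\<theta> \<in> {0<..<1}" by (cases "\<theta> = 0"; cases "\<theta> = 1") auto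
  with \<theta> show ?thesis
  proof (intro ex1I conjI)
    fix \<theta>' assume "\<theta>' \<in> {0<..<1} \<and> F_fun M 0 \<theta>' = 0"
    with \<theta> F_fun_pos_smaller_theta[of \<theta> \<theta>'] F_fun_pos_smaller_theta[of \<theta>' \<theta>] show "\<theta>' = \<theta>"
      by (cases \<theta> \<theta>' rule: linorder_cases) auto
  qed auto
qed

text \<open>Only the empty state imposes a condition: if joining there is not harmful, it is strictly
beneficial at every \<open>n \<ge> 1\<close>, where joining is prescribed. In the empty state, an interior \<open>\<theta>\<close>
requires indifference.\<close>

lemma equilibrium_rev_threshold:
  assumes "0 < \<theta>" "\<theta> \<le> 1"
  shows "equilibrium M (rev_threshold 0 \<theta>) \<longleftrightarrow>
           F_fun M 0 \<theta> \<ge> 0 \<and> (\<theta> < 1 \<longrightarrow> F_fun M 0 \<theta> = 0)"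
proof -
  have le: "0 \<le> \<theta>" using assms by simp
  have "equilibrium M (rev_threshold 0 \<theta>) \<longleftrightarrow>
      (\<forall>n. (F_fun M n \<theta> > 0 \<longrightarrow> rev_threshold 0 \<theta> n = 1) \<and>
           (F_fun M n \<theta> < 0 \<longrightarrow> rev_threshold 0 \<theta> n = 0))"
    unfolding equilibrium_iff[OF rev_threshold_strategy[OF le assms(2)]
        level_equations_rev_threshold[OF le assms(2)]] net_gain_rev_threshold[OF le assms(2)]
    using assms by (auto simp: zero_less_mult_iff mult_less_0_iff)
  also have "\<dots> \<longleftrightarrow> F_fun M 0 \<theta> \<ge> 0 \<and> (\<theta> < 1 \<longrightarrow> F_fun M 0 \<theta> = 0)" (is "?L \<longleftrightarrow> ?R")
  proof
    assume ?L
    then have "(F_fun M 0 \<theta> > 0 \<longrightarrow> \<theta> = 1) \<and> (F_fun M 0 \<theta> < 0 \<longrightarrow> \<theta> = 0)"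
      by (metis rev_threshold_def less_irrefl)
    with assms show ?R by auto
  next
    assume R: ?R
    have "\<not> F_fun M n \<theta> < 0" if "n > 0" for n
      using F_fun_pos_larger_n[OF assms that] R by simp
    with R assms show ?L by (auto simp: rev_threshold_def)
  qed
  finally show ?thesis .
qed

text \<open>As \<open>F(0,\<theta>)\<close> changes sign at most once on \<open>[0,1]\<close>, from positive to negative, the three
conditions exclude one another and exhaust all possibilities.\<close>

lemma rt_equilibria_cases:
  shows "F_fun M 0 1 \<ge> 0 \<Longrightarrow> rt_equilibria M = {always_join}"
    and "F_fun M 0 0 \<le> 0 \<Longrightarrow> rt_equilibria M = {always_balk}"
    and "F_fun M 0 1 < 0 \<Longrightarrow> F_fun M 0 0 > 0 \<Longrightarrow> rt_equilibria M =
           {rev_threshold 0 (THE \<theta>. \<theta> \<in> {0<..<1} \<and> F_fun M 0 \<theta> = 0)}"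
proof -
  have eq: "rt_equilibria M = (if F_fun M 0 1 \<ge> 0 then {always_join} else {})
      \<union> (if F_fun M 0 0 \<le> 0 then {always_balk} else {})
      \<union> {rev_threshold 0 \<theta> | \<theta>. \<theta> \<in> {0<..<1} \<and> F_fun M 0 \<theta> = 0}"
    unfolding rt_equilibria_def S_rt_def
    using equilibrium_rev_threshold equilibrium_always_balk
    by (auto simp: always_join_def)
  show "rt_equilibria M = {always_join}" if "F_fun M 0 1 \<ge> 0"
  proof -
    have "F_fun M 0 \<theta> > 0" if "0 \<le> \<theta>" "\<theta> < 1" for \<theta>
      using F_fun_pos_smaller_theta[of \<theta> 1] that \<open>F_fun M 0 1 \<ge> 0\<close> by simp
    from this[of 0] this have "\<not> F_fun M 0 0 \<le> 0 \<and> (\<forall>\<theta>. \<not> (\<theta> \<in> {0<..<1} \<and> F_fun M 0 \<theta> = 0))"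
      by (metis greaterThanLessThan_iff less_eq_real_def less_irrefl not_le zero_less_one)
    with that show ?thesis unfolding eq by auto
  qed
  show "rt_equilibria M = {always_balk}" if "F_fun M 0 0 \<le> 0"
  proof -
    have "F_fun M 0 \<theta> < 0" if "0 < \<theta>" "\<theta> \<le> 1" for \<theta>
      using F_fun_pos_smaller_theta[of 0 \<theta>] that \<open>F_fun M 0 0 \<le> 0\<close> by force
    from this[of 1] this have "\<not> F_fun M 0 1 \<ge> 0 \<and> (\<forall>\<theta>. \<not> (\<theta> \<in> {0<..<1} \<and> F_fun M 0 \<theta> = 0))"
      by (metis greaterThanLessThan_iff less_eq_real_def less_irrefl not_le zero_less_one)
    with that show ?thesis unfolding eq by auto
  qed
  show "rt_equilibria M = {rev_threshold 0 (THE \<theta>. \<theta> \<in> {0<..<1} \<and> F_fun M 0 \<theta> = 0)}"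
    if *: "F_fun M 0 1 < 0" "F_fun M 0 0 > 0"
  proof -
    from theI'[OF F_fun_root[OF *]] F_fun_root[OF *]
    have root: "{\<theta>. \<theta> \<in> {0<..<1} \<and> F_fun M 0 \<theta> = 0} = {THE \<theta>. \<theta> \<in> {0<..<1} \<and> F_fun M 0 \<theta> = 0}"
      by blast
    have "{rev_threshold 0 \<theta> | \<theta>. \<theta> \<in> {0<..<1} \<and> F_fun M 0 \<theta> = 0}
        = rev_threshold 0 ` {\<theta>. \<theta> \<in> {0<..<1} \<and> F_fun M 0 \<theta> = 0}"
      by blast
    also have "\<dots> = {rev_threshold 0 (THE \<theta>. \<theta> \<in> {0<..<1} \<and> F_fun M 0 \<theta> = 0)}"
      unfolding root by (rule image_insert[of _ _ "{}", unfolded image_empty])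
    finally have "{rev_threshold 0 \<theta> | \<theta>. \<theta> \<in> {0<..<1} \<and> F_fun M 0 \<theta> = 0}
        = {rev_threshold 0 (THE \<theta>. \<theta> \<in> {0<..<1} \<and> F_fun M 0 \<theta> = 0)}" .
    with * show ?thesis unfolding eq by simp
  qed
qed

lemma H_U_strict_mono: "strict_mono (H_U M)"
proof (rule strict_monoI)
  fix n m :: nat assume "n < m"
  then show "H_U M n < H_U M m"
    using F_G_mono_n[of 1 n m] G_fun_pos[of 1] by (simp add: H_U_def divide_simps)
qed

text \<open>A benefit never exceeds the reward, so the increasing sequence \<open>H_U\<close> is bounded.\<close>

lemma H_U_convergent: "convergent (H_U M)"
proof (rule Bseq_mono_convergent)
  show "Bseq (H_U M)"
  proof (rule BseqI')
    fix n :: nat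
    have "H_U M n \<le> reward M"
      using F_fun_le[of n] G_fun_pos[of 1 n] by (simp add: H_U_def divide_simps)
    moreover have "H_U M 0 \<le> H_U M n"
      using strict_mono_mono[OF H_U_strict_mono] by (simp add: monoD)
    ultimately show "norm (H_U M n) \<le> \<bar>H_U M 0\<bar> + reward M"
      using less_imp_le[OF rates_pos(4)] by (auto simp: abs_le_iff)
  qed
  show "\<forall>m n. m \<le> n \<longrightarrow> H_U M m \<le> H_U M n"
    using strict_mono_mono[OF H_U_strict_mono] by (simp add: monoD)
qed

lemma H_U_le_lim: "H_U M n \<le> lim (H_U M)"
  using incseq_le[OF strict_mono_mono[OF H_U_strict_mono]] H_U_convergent
  by (simp add: convergent_LIMSEQ_iff)

text \<open>\<open>F(0,0)\<close> is the sum of all \<open>F(n,1)\<close>, and an increasing sequence stays below its limit.\<close>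

lemma F_fun_0_0_nonpos:
  assumes "lim (H_U M) \<le> 0"
  shows "F_fun M 0 0 \<le> 0"
proof -
  have F: "F_fun M n 1 \<le> 0" for n
  proof -
    have "F_fun M n 1 / G_fun M n 1 \<le> 0"
      using H_U_le_lim[of n] assms unfolding H_U_def by linarith
    then show ?thesis using G_fun_pos[of 1 n] by (simp add: divide_le_0_iff)
  qed
  have eq: "F_fun M n 1 = net1 * rt1 ^ n + net2 * rt2 ^ n" for n
    by (simp add: F_fun_closed thinned_tail_def)
  have "F_fun M 0 0 = - (\<Sum>\<^sub>\<infinity>n. - F_fun M n 1)"
    unfolding eq infsum_uminus by (simp add: F_fun_def rt1_def rt2_def atLeast_0)
  moreover have "(\<Sum>\<^sub>\<infinity>n. - F_fun M n 1) \<ge> 0" by (rule infsum_nonneg) (use F in simp)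
  ultimately show ?thesis by simp
qed

end

lemma Inf_enat_ge_1_iff: "Inf A \<ge> (1 :: enat) \<longleftrightarrow> 0 \<notin> A"
  by (auto simp: le_Inf_iff one_eSuc ileI1 iless_eSuc0) (metis ileI1 not_gr_zero)

theorem theorem5p2:
  fixes M :: clearing_model
  assumes "positive_params M"
    and "(visit_rate M E1 - visit_rate M E2) * (rho M E1 - rho M E2) > 0"
  shows "(\<exists>s\<in>S_rt. equilibrium M s) \<and>
    convergent (H_U M) \<and>
    (H_U M 0 > 0 \<longrightarrow> rt_equilibria M = {always_join}) \<and>
    (H_U M 0 \<le> 0 \<and> lim (H_U M) > 0 \<longrightarrow>
       (m_U_minus M = 0 \<longrightarrow> rt_equilibria M = {always_join}) \<and>
       (m_L_plus M \<ge> 1 \<longrightarrow> rt_equilibria M = {always_balk}) \<and>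
       (m_U_minus M \<noteq> 0 \<and> \<not> m_L_plus M \<ge> 1 \<longrightarrow>
          (\<exists>!\<theta>. \<theta> \<in> {0<..<1} \<and> F_fun M 0 \<theta> = 0) \<and>
          rt_equilibria M = {rev_threshold 0 (THE \<theta>. \<theta> \<in> {0<..<1} \<and> F_fun M 0 \<theta> = 0)})) \<and>
    (lim (H_U M) \<le> 0 \<longrightarrow> rt_equilibria M = {always_balk})"
proof -
  interpret clearing_reverse M
    using assms by unfold_locales
  have "rt_equilibria M \<noteq> {}"
    using rt_equilibria_cases by (cases "F_fun M 0 1 \<ge> 0"; cases "F_fun M 0 0 \<le> 0") auto
  then have ex: "\<exists>s\<in>S_rt. equilibrium M s" by (auto simp: rt_equilibria_def)
  have H0: "H_U M 0 > 0 \<Longrightarrow> F_fun M 0 1 \<ge> 0"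
    using G_fun_pos[of 1 0] by (simp add: H_U_def zero_less_divide_iff)
  have U: "m_U_minus M = 0 \<longleftrightarrow> F_fun M 0 1 \<ge> 0"
  proof -
    have "m_U_minus M = 0 \<longleftrightarrow> \<not> m_U_minus M \<ge> 1" by (simp add: not_le one_eSuc iless_eSuc0)
    then show ?thesis unfolding m_U_minus_def Inf_enat_ge_1_iff by (auto simp: zero_enat_def)
  qed
  have L: "m_L_plus M \<ge> 1 \<longleftrightarrow> F_fun M 0 0 \<le> 0"
    unfolding m_L_plus_def Inf_enat_ge_1_iff by (auto simp: zero_enat_def not_less)
  show ?thesis
    using ex H_U_convergent H0 U L rt_equilibria_cases F_fun_root F_fun_0_0_nonpos
    by (auto simp: not_le)
qed

end
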